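(* Let $N\ge 2$. Let $f\in C^2(\mathbb{R})$ be convex and monotone increasing with $f(0)>0$ and $\lim_{s\to\infty} f(s)/s=+\infty$, and set $a_*:=\min_{s>0} f(s)/s$. For $\varepsilon\in(0,1)$ let $$\Omega_\varepsilon:=\Big\{(x_1,\dots,x_{N+1})\in\mathbb{R}^{N+1}\,:\,\sum_{i=1}^{N+1}x_i^2=1,\ \cos((1-\varepsilon)\pi)<x_{N+1}\le 1\Big\}\subset\mathbb{S}^N,$$ let $\lambda_1(\Omega_\varepsilon)$ be the principal Dirichlet eigenvalue of $-\Delta_{\mathbb{S}^N}$ in $\Omega_\varepsilon$, and let $$\lambda^*_{\Omega_\varepsilon}:=\sup\{\lambda>0:\ \text{the problem } -\Delta_{\mathbb{S}^N}u=\lambda f(u)\text{ in }\Omega_\varepsilon,\ u=0\text{ on }\partial\Omega_\varepsilon \text{ has a classical positive solution}\}.$$ Then, as $\varepsilon\to 0$, $$\lambda^*_{\Omega_\varepsilon}=\frac{\lambda_1(\Omega_\varepsilon)}{a_*}\,(1+o(1)).$$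
   Context: $\Delta_{\mathbb{S}^N}$ is the Laplace–Beltrami operator on the unit sphere $\mathbb{S}^N\subset\mathbb{R}^{N+1}$. Under the assumptions on $f$, $a_*>0$. *)

theory Defs
  imports "HOL-Analysis.Analysis"
begin

text \<open>Points of R^(N+1) are pairs (y,t) with y in R^N (index type 'n, CARD('n) = N)
  and t the last coordinate x_(N+1).\<close>

definition C2_on :: "'a::euclidean_space set \<Rightarrow> ('a \<Rightarrow> real) \<Rightarrow> bool" where
  "C2_on S g \<longleftrightarrow>
     (\<forall>x\<in>S. g differentiable at x) \<and>
     (\<forall>v. \<forall>x\<in>S. (\<lambda>y. frechet_derivative g (at y) v) differentiable at x) \<and>
     (\<forall>v w. continuous_on S (\<lambda>x. frechet_derivative (\<lambda>y. frechet_derivative g (at y) v) (at x) w))"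

definition laplacian :: "('a::euclidean_space \<Rightarrow> real) \<Rightarrow> 'a \<Rightarrow> real" where
  "laplacian g x = (\<Sum>b\<in>Basis. frechet_derivative (\<lambda>y. frechet_derivative g (at y) b) (at x) b)"

definition hom_ext :: "('a::real_normed_vector \<Rightarrow> real) \<Rightarrow> 'a \<Rightarrow> real" where
  "hom_ext u y = u (y /\<^sub>R norm y)"

text \<open>Laplace-Beltrami operator on the unit sphere: ambient Laplacian of the 0-homogeneous
  extension, evaluated on the sphere.\<close>
definition sphere_laplacian :: "('a::euclidean_space \<Rightarrow> real) \<Rightarrow> 'a \<Rightarrow> real" where
  "sphere_laplacian u x = laplacian (hom_ext u) x"

definition cone_over :: "'a::real_normed_vector set \<Rightarrow> 'a set" where
  "cone_over \<Omega> = {y. y \<noteq> 0 \<and> y /\<^sub>R norm y \<in> \<Omega>}"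

text \<open>Relative boundary of a relatively open subset of the sphere.\<close>
definition sphere_bdry :: "'a::real_normed_vector set \<Rightarrow> 'a set" where
  "sphere_bdry \<Omega> = closure \<Omega> - \<Omega>"

definition classical_on :: "'a::euclidean_space set \<Rightarrow> ('a \<Rightarrow> real) \<Rightarrow> bool" where
  "classical_on \<Omega> u \<longleftrightarrow> C2_on (cone_over \<Omega>) (hom_ext u) \<and> continuous_on (closure \<Omega>) u"

definition cap :: "real \<Rightarrow> ((real^'n) \<times> real) set" where
  "cap \<epsilon> = {(y, t). norm y ^ 2 + t ^ 2 = 1 \<and> cos ((1 - \<epsilon>) * pi) < t \<and> t \<le> 1}"

definition principal_eigenvalue :: "'a::euclidean_space set \<Rightarrow> real" where
  "principal_eigenvalue \<Omega> = Inf {lam. \<exists>u. classical_on \<Omega> u \<and> (\<exists>x\<in>\<Omega>. u x \<noteq> 0) \<and>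
       (\<forall>x\<in>sphere_bdry \<Omega>. u x = 0) \<and>
       (\<forall>x\<in>\<Omega>. - sphere_laplacian u x = lam * u x)}"

definition extremal_parameter :: "(real \<Rightarrow> real) \<Rightarrow> 'a::euclidean_space set \<Rightarrow> real" where
  "extremal_parameter f \<Omega> = Sup {lam. lam > 0 \<and> (\<exists>u. classical_on \<Omega> u \<and> (\<forall>x\<in>\<Omega>. u x > 0) \<and>
       (\<forall>x\<in>sphere_bdry \<Omega>. u x = 0) \<and>
       (\<forall>x\<in>\<Omega>. - sphere_laplacian u x = lam * f (u x)))}"

end

theory Submission
  imports Defs "HOL-Real_Asymp.Real_Asymp"
begin

text \<open>
  In the coordinate \<open>z = (1 - cos \<theta>)/2\<close>, where \<open>\<theta>\<close> is the distance to the north pole, the Laplacian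
  of a zonal function \<open>g(z)\<close> on the \<open>N\<close>-sphere is \<open>z(1-z)g'' + (N/2)(1-2z)g'\<close>, and the domain is
  \<open>{z < b}\<close> with \<open>b \<rightarrow> 1\<close>. Let \<open>S\<close> be the maximum of the torsion function, the solution of
  \<open>- \<Delta> \<tau> = 1\<close> with zero boundary values; it tends to infinity because \<open>N \<ge> 2\<close>.

  \<^item> Comparing a solution with a Dirichlet eigenfunction by the maximum principle gives
    \<open>\<lambda>\<^sup>* a\<^sub>* \<le> \<lambda>\<^sub>1\<close>, since \<open>f(u) \<ge> a\<^sub>* u\<close> and \<open>f(u) \<ge> f(0) > 0\<close>.
  \<^item> If \<open>f(s)/s\<close> is minimal at \<open>s\<^sub>*\<close>, then \<open>f\<close> has Lipschitz constant \<open>a\<^sub>*\<close> on \<open>[0, s\<^sub>*]\<close>, so for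
    \<open>\<lambda> a\<^sub>* S < 1\<close> the map \<open>u \<mapsto> \<lambda> G(f(u))\<close>, with \<open>G\<close> the Green operator, contracts the set
    \<open>0 \<le> u \<le> s\<^sub>*\<close> and has a fixed point; thus \<open>\<lambda>\<^sup>* \<ge> 1 / (a\<^sub>* S)\<close>.
  \<^item> The zonal eigenfunctions are hypergeometric series, and comparing coefficients with those of the
    torsion function yields \<open>\<lambda>\<^sub>1 \<le> (1 + 2/S)/S\<close>.

  The quotient therefore lies between \<open>1/(1 + 2/S)\<close> and \<open>1\<close>.
\<close>

section \<open>Maximum principle on domains of the sphere\<close>

lemma C2_on_lincomb:
  assumes S: "open S" and g: "C2_on S g" and h: "C2_on S h"
  shows "C2_on S (\<lambda>x. a * g x + b * h x)" (is "C2_on S ?k")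
    and "x \<in> S \<Longrightarrow> laplacian (\<lambda>x. a * g x + b * h x) x = a * laplacian g x + b * laplacian h x"
proof -
  have d1: "(?k has_derivative (\<lambda>v. a * frechet_derivative g (at x) v + b * frechet_derivative h (at x) v)) (at x)"
    if "x \<in> S" for x
    using g h that unfolding C2_on_def
    by (intro has_derivative_add has_derivative_mult_right) (auto simp: frechet_derivative_works[symmetric])
  have d1': "frechet_derivative ?k (at x) = (\<lambda>v. a * frechet_derivative g (at x) v + b * frechet_derivative h (at x) v)"
    if "x \<in> S" for x by (rule frechet_derivative_at[OF d1[OF that], symmetric])
  \<comment> \<open>The formula \<open>d1'\<close> holds on the whole open set \<open>S\<close>, so
    it can be differentiated once more at each of its points.\<close>
  have d2: "((\<lambda>x. frechet_derivative ?k (at x) v) has_derivative (\<lambda>w.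
       a * frechet_derivative (\<lambda>x. frechet_derivative g (at x) v) (at x) w
     + b * frechet_derivative (\<lambda>x. frechet_derivative h (at x) v) (at x) w)) (at x)"
    if "x \<in> S" for x v
  proof (rule has_derivative_transform_within_open[OF _ S that])
    show "((\<lambda>x. a * frechet_derivative g (at x) v + b * frechet_derivative h (at x) v) has_derivative (\<lambda>w.
       a * frechet_derivative (\<lambda>x. frechet_derivative g (at x) v) (at x) w
     + b * frechet_derivative (\<lambda>x. frechet_derivative h (at x) v) (at x) w)) (at x)"
      using g h that unfolding C2_on_def
      by (intro has_derivative_add has_derivative_mult_right) (auto simp: frechet_derivative_works[symmetric])
  qed (simp add: d1')
  have d2': "frechet_derivative (\<lambda>x. frechet_derivative ?k (at x) v) (at x) = (\<lambda>w.
       a * frechet_derivative (\<lambda>x. frechet_derivative g (at x) v) (at x) w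
     + b * frechet_derivative (\<lambda>x. frechet_derivative h (at x) v) (at x) w)"
    if "x \<in> S" for x v by (rule frechet_derivative_at[OF d2[OF that], symmetric])
  have "continuous_on S (\<lambda>x. frechet_derivative (\<lambda>x. frechet_derivative ?k (at x) v) (at x) w)" for v w
  proof (rule continuous_on_eq)
    show "continuous_on S (\<lambda>x. a * frechet_derivative (\<lambda>x. frechet_derivative g (at x) v) (at x) w
     + b * frechet_derivative (\<lambda>x. frechet_derivative h (at x) v) (at x) w)"
      using g h unfolding C2_on_def by (intro continuous_intros) auto
  qed (simp add: d2')
  then show "C2_on S ?k" 
    unfolding C2_on_def using differentiableI[OF d1] differentiableI[OF d2] by blast
  show "laplacian ?k x = a * laplacian g x + b * laplacian h x" if "x \<in> S"
    using that by (simp add: laplacian_def d2' sum.distrib sum_distrib_left)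
qed

text \<open>Since \<open>\<psi> 0 = 0\<close>, a negative \<open>c\<close> would make
  \<open>\<psi>\<close> negative just to the right of 0, and the mean value theorem would push
  \<open>\<phi>\<close> below its minimum.\<close>

lemma local_min_second_derivative_nonneg:
  fixes \<phi> \<psi> :: "real \<Rightarrow> real"
  assumes d: "d > 0" and \<phi>: "\<And>s. \<bar>s\<bar> < d \<Longrightarrow> (\<phi> has_field_derivative \<psi> s) (at s)"
    and \<psi>: "(\<psi> has_field_derivative c) (at 0)"
    and min: "\<And>s. \<bar>s\<bar> < d \<Longrightarrow> \<phi> 0 \<le> \<phi> s"
  shows "c \<ge> 0"
proof (rule ccontr)
  assume "\<not> c \<ge> 0"
  then obtain d' where d': "d' > 0" "\<And>h. 0 < h \<Longrightarrow> h < d' \<Longrightarrow> \<psi> (0 + h) < \<psi> 0"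
    using DERIV_neg_dec_right[OF \<psi>] by auto
  have "\<psi> 0 = 0" using DERIV_local_min[OF \<phi>[of 0] d] d min by auto
  define h where "h = min d d' / 2"
  have h: "0 < h" "h < d" "h < d'" using d d' by (auto simp: h_def)
  obtain \<xi> where "0 < \<xi>" "\<xi> < h" "\<phi> h - \<phi> 0 = (h - 0) * \<psi> \<xi>"
    using MVT2[of 0 h \<phi> \<psi>] \<phi> h by auto
  moreover then have "\<psi> \<xi> < 0" using d'(2)[of \<xi>] h \<open>\<psi> 0 = 0\<close> by auto
  ultimately have "\<phi> h < \<phi> 0" using h by (smt (verit) mult_pos_neg)
  then show False using min[of h] h by auto
qed

text \<open>Each summand is a second derivative along a coordinate line, to which the one-variable
  test applies.\<close>

lemma laplacian_nonneg_at_local_min: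
  assumes S: "open S" "x \<in> S" and g: "C2_on S g" and min: "\<And>y. y \<in> S \<Longrightarrow> g x \<le> g y"
  shows "laplacian g x \<ge> 0"
  unfolding laplacian_def
proof (rule sum_nonneg)
  fix b :: 'a assume b: "b \<in> Basis"
  obtain d where d: "d > 0" "ball x d \<subseteq> S" using S open_contains_ball by blast
  have mem: "x + s *\<^sub>R b \<in> S" if "\<bar>s\<bar> < d" for s
    using that d b by (intro subsetD[OF d(2)]) (simp add: dist_norm)
  have line: "((\<lambda>s. k (x + s *\<^sub>R b)) has_field_derivative frechet_derivative k (at (x + s *\<^sub>R b)) b) (at s)"
    if "k differentiable at (x + s *\<^sub>R b)" for k :: "'a \<Rightarrow> real" and s
  proof -
    have "((\<lambda>s. k (x + s *\<^sub>R b)) has_derivative (\<lambda>h. frechet_derivative k (at (x + s *\<^sub>R b)) (h *\<^sub>R b))) (at s)"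
      by (rule has_derivative_compose[of "\<lambda>s. x + s *\<^sub>R b"]) (use that in \<open>auto intro!: derivative_eq_intros simp: frechet_derivative_works[symmetric]\<close>)
    moreover have "linear (frechet_derivative k (at (x + s *\<^sub>R b)))"
      using that by (rule linear_frechet_derivative)
    ultimately show ?thesis by (simp add: has_field_derivative_def linear_scale mult_commute_abs)
  qed
  show "0 \<le> frechet_derivative (\<lambda>y. frechet_derivative g (at y) b) (at x) b"
  proof (rule local_min_second_derivative_nonneg[OF d(1)])
    show "((\<lambda>s. g (x + s *\<^sub>R b)) has_field_derivative frechet_derivative g (at (x + s *\<^sub>R b)) b) (at s)"
      if "\<bar>s\<bar> < d" for s
      using line mem[OF that] g by (auto simp: C2_on_def)
    show "((\<lambda>s. frechet_derivative g (at (x + s *\<^sub>R b)) b) has_field_derivative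
        frechet_derivative (\<lambda>y. frechet_derivative g (at y) b) (at x) b) (at 0)"
      using line[of "\<lambda>y. frechet_derivative g (at y) b" 0] g S by (auto simp: C2_on_def)
  qed (use mem min in auto)
qed

text \<open>Openness is asked of the cone because \<open>laplacian\<close> acts in the ambient
  space: the 0-homogeneous extension is differentiated there.\<close>

locale sphere_domain =
  fixes \<Omega> :: "'a::euclidean_space set"
  assumes unit: "\<Omega> \<subseteq> sphere 0 1" and open_cone: "open (cone_over \<Omega>)"
begin

lemma compact_closure_domain: "compact (closure \<Omega>)"
  using bounded_subset[OF bounded_sphere unit] by simp

lemma hom_ext_domain: "x \<in> \<Omega> \<Longrightarrow> hom_ext u x = u x"
  using unit by (auto simp: hom_ext_def)

lemma domain_subset_cone: "\<Omega> \<subseteq> cone_over \<Omega>"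
  using unit by (auto simp: cone_over_def)

lemma hom_ext_lincomb: "hom_ext (\<lambda>x. a * u x + b * v x) = (\<lambda>y. a * hom_ext u y + b * hom_ext v y)"
  by (simp add: hom_ext_def fun_eq_iff)

lemma classical_lincomb:
  assumes "classical_on \<Omega> u" "classical_on \<Omega> v"
  shows "classical_on \<Omega> (\<lambda>x. a * u x + b * v x)"
  using assms C2_on_lincomb(1)[OF open_cone] unfolding classical_on_def hom_ext_lincomb
  by (auto intro!: continuous_intros)

lemma sphere_laplacian_lincomb:
  assumes "classical_on \<Omega> u" "classical_on \<Omega> v" "x \<in> \<Omega>"
  shows "sphere_laplacian (\<lambda>x. a * u x + b * v x) x = a * sphere_laplacian u x + b * sphere_laplacian v x"
  using assms C2_on_lincomb(2)[OF open_cone] domain_subset_cone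
  unfolding classical_on_def sphere_laplacian_def hom_ext_lincomb by blast

text \<open>A negative minimum over the compact closure lies in \<open>\<Omega>\<close>. By
  homogeneity it is also a minimum over the open cone, so the ambient Laplacian is nonnegative
  there, against \<open>super\<close>. Strictness is assumed only where \<open>w < 0\<close>, which
  is what the combinations of \<open>u\<close> and \<open>\<phi>\<close> below can provide.\<close>

lemma weak_minimum_principle:
  assumes w: "classical_on \<Omega> w" and bdry: "\<And>x. x \<in> sphere_bdry \<Omega> \<Longrightarrow> w x \<ge> 0"
    and super: "\<And>x. x \<in> \<Omega> \<Longrightarrow> w x < 0 \<Longrightarrow> - sphere_laplacian w x > 0"
    and y: "y \<in> \<Omega>"
  shows "w y \<ge> 0"
proof (rule ccontr)
  assume neg: "\<not> w y \<ge> 0"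
  have cont: "continuous_on (closure \<Omega>) w" and C2: "C2_on (cone_over \<Omega>) (hom_ext w)"
    using w by (auto simp: classical_on_def)
  have "closure \<Omega> \<noteq> {}" using y by auto
  then obtain x where x: "x \<in> closure \<Omega>" "\<And>z. z \<in> closure \<Omega> \<Longrightarrow> w x \<le> w z"
    using continuous_attains_inf[OF compact_closure_domain _ cont] by metis
  have "w x < 0" using x(2)[of y] y neg closure_subset by fastforce
  with bdry[of x] x(1) have x\<Omega>: "x \<in> \<Omega>" by (force simp: sphere_bdry_def)
  have "laplacian (hom_ext w) x \<ge> 0"
  proof (rule laplacian_nonneg_at_local_min[OF open_cone _ C2])
    show "hom_ext w x \<le> hom_ext w z" if "z \<in> cone_over \<Omega>" for z
      unfolding hom_ext_domain[OF x\<Omega>] unfolding hom_ext_def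
      using that closure_subset[of \<Omega>] by (intro x(2)) (auto simp: cone_over_def)
  qed (use domain_subset_cone x\<Omega> in auto)
  then show False using super[OF x\<Omega> \<open>w x < 0\<close>] by (simp add: sphere_laplacian_def)
qed

text \<open>No Hopf lemma is needed to find a finite \<open>t\<close> with \<open>\<phi> \<le> t u\<close>, because \<open>- \<Delta> u \<ge> m > 0\<close>. If \<open>c > \<mu>\<close>,
  the smallest such \<open>t\<close> could be decreased.\<close>

lemma eigenvalue_ge_supersolution_rate_aux:
  assumes \<phi>: "classical_on \<Omega> \<phi>" "x0 \<in> \<Omega>" "\<phi> x0 > 0" "\<And>x. x \<in> sphere_bdry \<Omega> \<Longrightarrow> \<phi> x = 0"
      "\<And>x. x \<in> \<Omega> \<Longrightarrow> - sphere_laplacian \<phi> x = \<mu> * \<phi> x"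
    and u: "classical_on \<Omega> u" "\<And>x. x \<in> \<Omega> \<Longrightarrow> u x > 0" "\<And>x. x \<in> sphere_bdry \<Omega> \<Longrightarrow> u x = 0"
    and h: "\<And>x. x \<in> \<Omega> \<Longrightarrow> - sphere_laplacian u x \<ge> m" "\<And>x. x \<in> \<Omega> \<Longrightarrow> - sphere_laplacian u x \<ge> c * u x"
    and m: "m > 0"
  shows "0 \<le> \<mu> \<and> c \<le> \<mu>"
proof -
  have lap: "- sphere_laplacian (\<lambda>x. a * u x + b * \<phi> x) x = a * (- sphere_laplacian u x) + b * (\<mu> * \<phi> x)"
    if "x \<in> \<Omega>" for a b x
  proof -
    have "sphere_laplacian \<phi> x = - (\<mu> * \<phi> x)" using \<phi>(5)[OF that] by linarith
    then show ?thesis by (simp add: sphere_laplacian_lincomb[OF u(1) \<phi>(1) that])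
  qed
  have wmp: "a * u y + b * \<phi> y \<ge> 0"
    if "\<And>x. x \<in> \<Omega> \<Longrightarrow> a * u x + b * \<phi> x < 0 \<Longrightarrow> a * (- sphere_laplacian u x) + b * (\<mu> * \<phi> x) > 0" "y \<in> \<Omega>" for a b y
    using weak_minimum_principle[OF classical_lincomb[OF u(1) \<phi>(1)], of a b y] that u(3) \<phi>(4) lap by simp
  \<comment> \<open>If \<open>\<mu> < 0\<close>, then \<open>- \<phi>\<close> satisfies the minimum
    principle, which forces \<open>\<phi> \<le> 0\<close> and contradicts
    \<open>\<phi> x0 > 0\<close>.\<close>
  have \<mu>: "\<mu> \<ge> 0"
  proof (rule ccontr)
    assume "\<not> \<mu> \<ge> 0"
    then have "0 * u x0 + (-1) * \<phi> x0 \<ge> 0"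
      by (intro wmp \<phi>(2)) (simp add: mult_neg_pos)
    then show False using \<phi>(3) by simp
  qed
  have "bounded (\<phi> ` closure \<Omega>)"
    using \<phi>(1) by (intro compact_imp_bounded compact_continuous_image compact_closure_domain)
      (auto simp: classical_on_def)
  then obtain M where M: "M > 0" "\<And>x. x \<in> \<Omega> \<Longrightarrow> \<phi> x \<le> M"
    unfolding bounded_pos using closure_subset by (metis abs_le_D1 image_eqI real_norm_def subsetD)
  define T where "T = {t. t \<ge> 0 \<and> (\<forall>x\<in>\<Omega>. \<phi> x \<le> t * u x)}"
  \<comment> \<open>With this factor the multiple of \<open>u\<close> has negative Laplacian at
    least \<open>\<mu> * M + 1\<close>, which strictly exceeds \<open>\<mu> * \<phi> x\<close>
    everywhere.\<close>
  have "(\<mu> * M + 1) / m \<in> T"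
  proof -
    have "(\<mu> * M + 1) / m * u x + (-1) * \<phi> x \<ge> 0" if "x \<in> \<Omega>" for x
    proof (rule wmp[OF _ that])
      fix x assume x: "x \<in> \<Omega>"
      have "\<mu> * \<phi> x \<le> \<mu> * M" using M x \<mu> by (simp add: mult_left_mono)
      also have "\<dots> < (\<mu> * M + 1) / m * m" using m by simp
      also have "\<dots> \<le> (\<mu> * M + 1) / m * (- sphere_laplacian u x)"
        using h(1)[OF x] m M \<mu> by (intro mult_left_mono) auto
      finally show "(\<mu> * M + 1) / m * (- sphere_laplacian u x) + - 1 * (\<mu> * \<phi> x) > 0" by simp
    qed
    then show ?thesis using M \<mu> m by (auto simp: T_def)
  qed
  then have T: "T \<noteq> {}" "bdd_below T" by (auto simp: T_def intro!: bdd_belowI[of _ 0])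
  define t where "t = Inf T"
  have t_le: "\<phi> x \<le> t * u x" if "x \<in> \<Omega>" for x
  proof -
    have "\<phi> x / u x \<le> t" unfolding t_def
      by (rule cInf_greatest[OF T(1)]) (use u(2)[OF that] that in \<open>auto simp: T_def field_simps\<close>)
    then show ?thesis using u(2)[OF that] by (simp add: field_simps)
  qed
  have t: "t > 0" using t_le[OF \<phi>(2)] \<phi>(3) u(2)[OF \<phi>(2)] by (smt (verit) mult_nonpos_nonneg)
  have "c \<le> \<mu>"
  proof (rule ccontr)
    assume "\<not> c \<le> \<mu>"
    then have c: "0 < c" "\<mu> < c" using \<mu> by auto
    \<comment> \<open>Splitting the negative Laplacian of \<open>u\<close> into its fractions
      \<open>\<mu> / c\<close> and \<open>1 - \<mu> / c\<close>, the first dominates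
      \<open>\<mu> * u\<close> and the second is at least \<open>\<eta>\<close>. This uniform
      surplus is what allows \<open>t\<close> to be lowered.\<close>
    define \<eta> where "\<eta> = (1 - \<mu> / c) * m"
    have \<eta>: "\<eta> > 0" using c m by (simp add: \<eta>_def)
    \<comment> \<open>Chosen so that enlarging \<open>\<phi>\<close> by the factor
      \<open>1 + \<delta>\<close> costs less than the surplus \<open>t * \<eta>\<close>; the summand
      1 keeps the denominator positive when \<open>\<mu> = 0\<close>.\<close>
    define \<delta> where "\<delta> = t * \<eta> / (\<mu> * M + 1)"
    have \<delta>: "\<delta> > 0" "\<delta> * (\<mu> * M) < t * \<eta>"
    proof -
      have p: "\<mu> * M + 1 > 0" using \<mu> M by (simp add: add_nonneg_pos)
      then show \<delta>: "\<delta> > 0" using t \<eta> by (simp add: \<delta>_def)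
      have "\<delta> * (\<mu> * M + 1) = t * \<eta>" using p by (simp add: \<delta>_def)
      then show "\<delta> * (\<mu> * M) < t * \<eta>" using \<delta> by (simp add: algebra_simps)
    qed
    have "t * u x + (- (1 + \<delta>)) * \<phi> x \<ge> 0" if "x \<in> \<Omega>" for x
    proof (rule wmp[OF _ that])
      fix x assume x: "x \<in> \<Omega>"
      let ?h = "- sphere_laplacian u x"
      have "\<mu> * u x \<le> \<mu> / c * ?h" using h(2)[OF x] c \<mu> mult_left_mono[of "c * u x" ?h "\<mu> / c"] by simp
      moreover have "\<eta> \<le> (1 - \<mu> / c) * ?h" unfolding \<eta>_def using h(1)[OF x] c by (intro mult_left_mono) auto
      ultimately have "\<eta> \<le> ?h - \<mu> * u x" by (simp add: algebra_simps)
      then have "t * \<eta> \<le> t * (?h - \<mu> * u x)" using t by (simp add: mult_left_mono)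
      moreover have "\<mu> * \<phi> x \<le> \<mu> * (t * u x)" using t_le[OF x] \<mu> by (rule mult_left_mono)
      moreover have "\<delta> * (\<mu> * \<phi> x) \<le> \<delta> * (\<mu> * M)" using M x \<mu> \<delta> by (simp add: mult_left_mono)
      ultimately show "t * ?h + - (1 + \<delta>) * (\<mu> * \<phi> x) > 0" using \<delta>(2) by (simp add: algebra_simps)
    qed
    then have "t / (1 + \<delta>) \<in> T" using t \<delta> by (auto simp: T_def field_simps)
    then have "t \<le> t / (1 + \<delta>)" unfolding t_def by (rule cInf_lower[OF _ T(2)])
    then show False using mult_pos_pos[OF \<delta>(1) t] t \<delta>(1) by (simp add: field_simps)
  qed
  then show ?thesis using \<mu> by simp
qed

text \<open>The auxiliary lemma asks for only one positive value of the eigenfunction, so a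
  sign-changing one is admissible after multiplication by its sign \<open>\<sigma>\<close> at a
  point where it does not vanish.\<close>

lemma eigenvalue_ge_supersolution_rate:
  assumes \<phi>: "classical_on \<Omega> \<phi>" "\<exists>x\<in>\<Omega>. \<phi> x \<noteq> 0" "\<And>x. x \<in> sphere_bdry \<Omega> \<Longrightarrow> \<phi> x = 0"
      "\<And>x. x \<in> \<Omega> \<Longrightarrow> - sphere_laplacian \<phi> x = \<mu> * \<phi> x"
    and u: "classical_on \<Omega> u" "\<And>x. x \<in> \<Omega> \<Longrightarrow> u x > 0" "\<And>x. x \<in> sphere_bdry \<Omega> \<Longrightarrow> u x = 0"
    and h: "\<And>x. x \<in> \<Omega> \<Longrightarrow> - sphere_laplacian u x \<ge> m" "\<And>x. x \<in> \<Omega> \<Longrightarrow> - sphere_laplacian u x \<ge> c * u x"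
    and m: "m > 0"
  shows "0 \<le> \<mu>" "c \<le> \<mu>"
proof -
  obtain x0 where x0: "x0 \<in> \<Omega>" "\<phi> x0 \<noteq> 0" using \<phi>(2) by auto
  define \<sigma> where "\<sigma> = sgn (\<phi> x0)"
  have "0 \<le> \<mu> \<and> c \<le> \<mu>"
  proof (rule eigenvalue_ge_supersolution_rate_aux[OF _ x0(1) _ _ _ u h m])
    show "classical_on \<Omega> (\<lambda>x. \<sigma> * \<phi> x + 0 * \<phi> x)" by (rule classical_lincomb[OF \<phi>(1) \<phi>(1)])
    show "\<sigma> * \<phi> x0 + 0 * \<phi> x0 > 0" using x0 by (auto simp: \<sigma>_def sgn_if)
    show "- sphere_laplacian (\<lambda>x. \<sigma> * \<phi> x + 0 * \<phi> x) x = \<mu> * (\<sigma> * \<phi> x + 0 * \<phi> x)" if "x \<in> \<Omega>" for x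
    proof -
      have "sphere_laplacian \<phi> x = - (\<mu> * \<phi> x)" using \<phi>(4)[OF that] by linarith
      then show ?thesis by (simp only: sphere_laplacian_lincomb[OF \<phi>(1) \<phi>(1) that]) simp
    qed
  qed (use \<phi>(3) in auto)
  then show "0 \<le> \<mu>" "c \<le> \<mu>" by auto
qed

end

section \<open>Zonal functions on caps\<close>

text \<open>The 0-homogeneous extension of \<open>(1 - cos \<theta>)/2\<close> for the pole \<open>e\<close>; \<open>polar_D\<close> and \<open>polar_D2\<close> are its
  directional derivatives.\<close>

definition polar :: "'a::euclidean_space \<Rightarrow> 'a \<Rightarrow> real" where
  "polar e p = (1 - (e \<bullet> p) * inverse (norm p)) / 2"

definition polar_D :: "'a::euclidean_space \<Rightarrow> 'a \<Rightarrow> 'a \<Rightarrow> real" where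
  "polar_D e v p = - ((e \<bullet> v) * inverse (norm p) - (e \<bullet> p) * (p \<bullet> v) * inverse (norm p) ^ 3) / 2"

definition polar_D2 :: "'a::euclidean_space \<Rightarrow> 'a \<Rightarrow> 'a \<Rightarrow> 'a \<Rightarrow> real" where
  "polar_D2 e v w p =
     ((e \<bullet> v) * (p \<bullet> w) + (e \<bullet> w) * (p \<bullet> v) + (e \<bullet> p) * (w \<bullet> v)) * inverse (norm p) ^ 3 / 2
     - 3 * (e \<bullet> p) * (p \<bullet> v) * (p \<bullet> w) * inverse (norm p) ^ 5 / 2"

lemma inverse_norm_has_derivative:
  fixes p :: "'a::euclidean_space"
  assumes "p \<noteq> 0"
  shows "((\<lambda>p. inverse (norm p)) has_derivative (\<lambda>v. - (p \<bullet> v) * inverse (norm p) ^ 3)) (at p)"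
proof -
  have "((\<lambda>p. inverse (norm p)) has_derivative
      (\<lambda>v. - (inverse (norm p) * (sgn p \<bullet> v) * inverse (norm p)))) (at p)"
    using assms by (auto intro!: derivative_eq_intros has_derivative_norm simp: inner_commute)
  moreover have "(\<lambda>v. - (inverse (norm p) * (sgn p \<bullet> v) * inverse (norm p)))
      = (\<lambda>v. - (p \<bullet> v) * inverse (norm p) ^ 3)"
    by (auto simp: sgn_div_norm power3_eq_cube)
  ultimately show ?thesis by metis
qed

lemma polar_has_derivative:
  assumes "p \<noteq> 0"
  shows "(polar e has_derivative (\<lambda>v. polar_D e v p)) (at p)"
proof -
  have "((\<lambda>p. (1 - (e \<bullet> p) * inverse (norm p)) / 2) has_derivative (\<lambda>v. polar_D e v p)) (at p)"
    unfolding polar_D_def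
    by ((rule inverse_norm_has_derivative[OF assms] derivative_eq_intros refl | simp; fail)+)
       (simp add: fun_eq_iff field_simps)
  then show ?thesis by (simp add: polar_def[abs_def])
qed

lemma polar_D_has_derivative:
  assumes "p \<noteq> 0"
  shows "(polar_D e v has_derivative (\<lambda>w. polar_D2 e v w p)) (at p)"
proof -
  have "((\<lambda>p. - ((e \<bullet> v) * inverse (norm p) - (e \<bullet> p) * (p \<bullet> v) * inverse (norm p) ^ 3) / 2)
      has_derivative (\<lambda>w. polar_D2 e v w p)) (at p)"
    unfolding polar_D2_def
    by ((rule inverse_norm_has_derivative[OF assms] derivative_eq_intros refl | simp; fail)+)
       (use assms in \<open>simp add: fun_eq_iff inner_commute divide_simps eval_nat_numeral, simp add: algebra_simps\<close>)
  then show ?thesis by (simp add: polar_D_def[abs_def])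
qed

lemma polar_continuous_intros:
  "continuous_on (- {0}) (polar e)" "continuous_on (- {0}) (polar_D e v)"
  "continuous_on (- {0}) (polar_D2 e v w)"
  by (auto simp: polar_def[abs_def] polar_D_def[abs_def] polar_D2_def[abs_def] intro!: continuous_intros)

section \<open>The Laplacian of a function of the polar coordinate\<close>

context
  fixes e :: "'a::euclidean_space" and g g1 g2 :: "real \<Rightarrow> real" and I :: "real set"
  assumes I: "open I"
    and g: "\<And>z. z \<in> I \<Longrightarrow> (g has_field_derivative g1 z) (at z)"
    and g1: "\<And>z. z \<in> I \<Longrightarrow> (g1 has_field_derivative g2 z) (at z)"
    and g2: "continuous_on I g2"
begin

lemma open_polar_preimage: "open {p. p \<noteq> 0 \<and> polar e p \<in> I}"
proof -
  have "open (- {0} \<inter> polar e -` I)"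
    by (rule continuous_open_preimage[OF polar_continuous_intros(1) _ I]) auto
  then show ?thesis by (simp add: Collect_conj_eq vimage_def Compl_eq)
qed

lemma radial_frechet1:
  assumes "p \<noteq> 0" "polar e p \<in> I"
  shows "((\<lambda>p. g (polar e p)) has_derivative (\<lambda>v. g1 (polar e p) * polar_D e v p)) (at p)"
  using has_derivative_compose[OF polar_has_derivative[OF assms(1)]
      g[OF assms(2), unfolded has_field_derivative_def]] by simp

lemma radial_frechet1':
  assumes "p \<noteq> 0" "polar e p \<in> I"
  shows "frechet_derivative (\<lambda>p. g (polar e p)) (at p) = (\<lambda>v. g1 (polar e p) * polar_D e v p)"
  using frechet_derivative_at[OF radial_frechet1[OF assms]] by simp

lemma radial_frechet2:
  assumes "p \<noteq> 0" "polar e p \<in> I"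
  shows "((\<lambda>p. frechet_derivative (\<lambda>p. g (polar e p)) (at p) v) has_derivative
     (\<lambda>w. g2 (polar e p) * polar_D e w p * polar_D e v p + g1 (polar e p) * polar_D2 e v w p)) (at p)"
proof (rule has_derivative_transform_within_open[OF _ open_polar_preimage])
  have "((\<lambda>p. g1 (polar e p)) has_derivative (\<lambda>v. g2 (polar e p) * polar_D e v p)) (at p)"
    using has_derivative_compose[OF polar_has_derivative[OF assms(1)]
      g1[OF assms(2), unfolded has_field_derivative_def]] by simp
  from has_derivative_mult[OF this polar_D_has_derivative[OF assms(1), of e v]]
  show "((\<lambda>p. g1 (polar e p) * polar_D e v p) has_derivative
     (\<lambda>w. g2 (polar e p) * polar_D e w p * polar_D e v p + g1 (polar e p) * polar_D2 e v w p)) (at p)"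
    by (simp add: algebra_simps)
qed (use assms in \<open>auto simp: radial_frechet1'\<close>)

lemma radial_frechet2':
  assumes "p \<noteq> 0" "polar e p \<in> I"
  shows "frechet_derivative (\<lambda>p. frechet_derivative (\<lambda>p. g (polar e p)) (at p) v) (at p)
    = (\<lambda>w. g2 (polar e p) * polar_D e w p * polar_D e v p + g1 (polar e p) * polar_D2 e v w p)"
  using frechet_derivative_at[OF radial_frechet2[OF assms]] by simp

lemma radial_C2:
  "C2_on {p. p \<noteq> 0 \<and> polar e p \<in> I} (\<lambda>p. g (polar e p))"
  unfolding C2_on_def
proof (intro conjI allI ballI)
  fix v w :: 'a
  let ?U = "{p. p \<noteq> 0 \<and> polar e p \<in> I}"
  have sub: "?U \<subseteq> - {0}" by auto
  have c1: "continuous_on I g1"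
    using g1 DERIV_continuous_on has_field_derivative_at_within by blast
  note [continuous_intros] = polar_continuous_intros[THEN continuous_on_subset, OF sub]
    continuous_on_compose2[OF c1] continuous_on_compose2[OF g2]
  have "continuous_on ?U
    (\<lambda>p. g2 (polar e p) * polar_D e w p * polar_D e v p + g1 (polar e p) * polar_D2 e v w p)"
    by (auto intro!: continuous_intros)
  then show "continuous_on ?U
     (\<lambda>x. frechet_derivative (\<lambda>y. frechet_derivative (\<lambda>p. g (polar e p)) (at y) v) (at x) w)"
    by (rule continuous_on_eq) (auto simp: radial_frechet2')
qed (auto simp: differentiable_def intro: radial_frechet1 radial_frechet2)

text \<open>The chain rule gives \<open>g2 z\<close> times the squared gradient of
  \<open>polar e\<close> plus \<open>g1 z\<close> times its Laplacian. On the unit sphere, with t =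
  1 - 2z, these are (1 - t^2)/4 = z(1 - z) and (d - 1)t/2, where d is the ambient dimension.\<close>

lemma radial_laplacian:
  assumes e: "norm e = 1" and p: "norm p = 1" "polar e p \<in> I"
  defines "z \<equiv> polar e p"
  shows "laplacian (\<lambda>p. g (polar e p)) p
    = z * (1 - z) * g2 z + (DIM('a) - 1) / 2 * (1 - 2 * z) * g1 z"
proof -
  have p0: "p \<noteq> 0" using p by auto
  define t where "t = e \<bullet> p"
  have z: "z = (1 - t) / 2" by (simp add: z_def polar_def t_def p)
  have pp: "p \<bullet> p = 1" "e \<bullet> e = 1" using p e by (simp_all add: dot_square_norm)
  have 1: "(\<Sum>b\<in>Basis. polar_D e b p * polar_D e b p) = (1 - t\<^sup>2) / 4"
  proof -
    \<comment> \<open>The gradient of \<open>polar e\<close> is minus half the component of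
      \<open>e\<close> orthogonal to \<open>p\<close>.\<close>
    have "polar_D e b p = - ((e - t *\<^sub>R p) \<bullet> b) / 2" for b
      by (simp add: polar_D_def p t_def inner_diff_left)
    then have "(\<Sum>b\<in>Basis. polar_D e b p * polar_D e b p)
       = (\<Sum>b\<in>Basis. (((e - t *\<^sub>R p) \<bullet> b) * ((e - t *\<^sub>R p) \<bullet> b)) / 4)" by simp
    also have "\<dots> = ((e - t *\<^sub>R p) \<bullet> (e - t *\<^sub>R p)) / 4"
      by (subst euclidean_inner) (simp add: sum_divide_distrib)
    also have "\<dots> = (1 - t\<^sup>2) / 4"
      by (simp add: inner_diff_left inner_diff_right pp t_def inner_commute power2_eq_square)
    finally show ?thesis .
  qed
  have 2: "(\<Sum>b\<in>Basis. polar_D2 e b b p) = (DIM('a) - 1) / 2 * t"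
  proof -
    have "(\<Sum>b\<in>Basis. polar_D2 e b b p) = (\<Sum>b\<in>Basis. (e \<bullet> b) * (p \<bullet> b) + t / 2 - 3 / 2 * t * ((p \<bullet> b) * (p \<bullet> b)))"
      by (intro sum.cong) (auto simp: polar_D2_def p t_def inner_Basis algebra_simps)
    also have "\<dots> = e \<bullet> p + DIM('a) * (t / 2) - 3 / 2 * t * (p \<bullet> p)"
      by (simp add: sum.distrib sum_subtractf sum_distrib_left euclidean_inner[of e p] euclidean_inner[of p p])
    also have "\<dots> = (DIM('a) - 1) / 2 * t" using DIM_positive[where 'a='a]
      by (simp add: pp t_def field_simps of_nat_diff)
    finally show ?thesis .
  qed
  have "laplacian (\<lambda>p. g (polar e p)) p
     = g2 z * (\<Sum>b\<in>Basis. polar_D e b p * polar_D e b p) + g1 z * (\<Sum>b\<in>Basis. polar_D2 e b b p)"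
    by (simp add: laplacian_def radial_frechet2'[OF p0 p(2)] z_def sum.distrib sum_distrib_left mult.assoc)
  also have "\<dots> = z * (1 - z) * g2 z + (DIM('a) - 1) / 2 * (1 - 2 * z) * g1 z"
    unfolding 1 2 z by (simp add: field_simps power2_eq_square)
  finally show ?thesis .
qed

end

section \<open>Caps as sublevel sets of the polar coordinate\<close>

definition cap_level :: "real \<Rightarrow> real" where
  "cap_level \<epsilon> = (1 - cos ((1 - \<epsilon>) * pi)) / 2"

definition zonal :: "(real \<Rightarrow> real) \<Rightarrow> 'b \<times> real \<Rightarrow> real" where
  "zonal g p = g ((1 - snd p) / 2)"

lemma norm_pair_eq_1_iff: "norm (y, t::real) = 1 \<longleftrightarrow> norm y ^ 2 + t ^ 2 = 1"
  by (simp add: norm_Pair)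

lemma mem_cap_iff:
  "p \<in> cap \<epsilon> \<longleftrightarrow> norm p = 1 \<and> (1 - snd p) / 2 < cap_level \<epsilon>"
proof (cases p)
  case (Pair y t)
  have "t \<le> 1" if "norm y ^ 2 + t ^ 2 = 1"
  proof -
    have "t\<^sup>2 \<le> 1" using that zero_le_power2[of "norm y"] by linarith
    then show ?thesis by (simp add: abs_square_le_1)
  qed
  then show ?thesis by (auto simp: Pair cap_def cap_level_def norm_pair_eq_1_iff)
qed

lemma closure_cap:
  assumes "p \<in> closure (cap \<epsilon>)"
  shows "norm p = 1" "0 \<le> (1 - snd p) / 2" "(1 - snd p) / 2 \<le> cap_level \<epsilon>"
proof -
  have "closed {p :: (real^'n) \<times> real. norm p = 1 \<and> (1 - snd p) / 2 \<le> cap_level \<epsilon>}"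
    by (intro closed_Collect_conj closed_Collect_eq closed_Collect_le continuous_intros) auto
  then have "closure (cap \<epsilon> :: ((real^'n) \<times> real) set) \<subseteq> {p. norm p = 1 \<and> (1 - snd p) / 2 \<le> cap_level \<epsilon>}"
    by (intro closure_minimal) (auto simp: mem_cap_iff)
  then show 1: "norm p = 1" "(1 - snd p) / 2 \<le> cap_level \<epsilon>" using assms by auto
  show "0 \<le> (1 - snd p) / 2" using norm_snd_le[of "snd p" "fst p"] 1 by simp
qed

lemma hom_ext_zonal: "hom_ext (zonal g) = (\<lambda>p. g (polar (0, 1) p))"
  by (simp add: fun_eq_iff hom_ext_def zonal_def polar_def inner_prod_def mult.commute)

lemma cone_over_cap: "cone_over (cap \<epsilon>) = {p. p \<noteq> 0 \<and> polar (0, 1) p < cap_level \<epsilon>}"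
  by (auto simp: cone_over_def mem_cap_iff polar_def inner_prod_def mult.commute)

lemma open_cone_over_cap: "open (cone_over (cap \<epsilon> :: ((real^'n) \<times> real) set))"
proof -
  have "open (- {0} \<inter> polar ((0, 1) :: (real^'n) \<times> real) -` {..<cap_level \<epsilon>})"
    by (rule continuous_open_preimage[OF polar_continuous_intros(1)]) auto
  then show ?thesis unfolding cone_over_cap by (simp add: Collect_conj_eq vimage_def Compl_eq lessThan_def)
qed

lemma polar_nonneg: "norm e = 1 \<Longrightarrow> 0 \<le> polar e p"
  using Cauchy_Schwarz_ineq2[of e p]
  by (cases "p = 0") (auto simp: polar_def field_simps abs_le_iff)

context
  fixes g g1 g2 :: "real \<Rightarrow> real" and a \<epsilon> :: real
  assumes a: "a < 0"
    and g: "\<And>z. a < z \<Longrightarrow> z < cap_level \<epsilon> \<Longrightarrow> (g has_field_derivative g1 z) (at z)"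
    and g1: "\<And>z. a < z \<Longrightarrow> z < cap_level \<epsilon> \<Longrightarrow> (g1 has_field_derivative g2 z) (at z)"
    and g2: "continuous_on {a<..<cap_level \<epsilon>} g2"
begin

text \<open>The profile is differentiable on an interval reaching below 0, although the polar
  coordinate is nonnegative. This makes the pole z = 0 an interior point for the profile, so that
  the zonal function is C2 across the pole.\<close>

lemma zonal_classical:
  assumes "continuous_on {0..cap_level \<epsilon>} g"
  shows "classical_on (cap \<epsilon> :: ((real^'n) \<times> real) set) (zonal g)"
  unfolding classical_on_def
proof
  have eq: "cone_over (cap \<epsilon> :: ((real^'n) \<times> real) set) = {p. p \<noteq> 0 \<and> polar (0, 1) p \<in> {a<..<cap_level \<epsilon>}}"
    unfolding cone_over_cap using a polar_nonneg[of "(0,1) :: (real^'n) \<times> real"]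
    by (auto simp: norm_Pair intro: less_le_trans)
  show "C2_on (cone_over (cap \<epsilon>)) (hom_ext (zonal g :: (real^'n) \<times> real \<Rightarrow> real))"
    unfolding eq hom_ext_zonal by (rule radial_C2[where ?g1.0=g1 and ?g2.0=g2]) (use g g1 g2 in auto)
  have "continuous_on (closure (cap \<epsilon> :: ((real^'n) \<times> real) set)) (\<lambda>p. g ((1 - snd p) / 2))"
    using closure_cap by (intro continuous_on_compose2[OF assms] continuous_intros) force+
  then show "continuous_on (closure (cap \<epsilon> :: ((real^'n) \<times> real) set)) (zonal g)"
    by (simp add: zonal_def[abs_def])
qed

lemma zonal_sphere_laplacian:
  fixes p :: "(real^'n) \<times> real"
  assumes "p \<in> cap \<epsilon>"
  defines "z \<equiv> (1 - snd p) / 2"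
  shows "sphere_laplacian (zonal g) p = z * (1 - z) * g2 z + CARD('n) / 2 * (1 - 2 * z) * g1 z"
proof -
  have z: "polar (0, 1) p = z" using assms by (simp add: polar_def mem_cap_iff z_def inner_prod_def)
  have "0 \<le> z" using polar_nonneg[of "(0,1) :: (real^'n) \<times> real" p] z by (simp add: norm_Pair)
  then have "z \<in> {a<..<cap_level \<epsilon>}" using a assms by (auto simp: mem_cap_iff z_def)
  then have "laplacian (\<lambda>p. g (polar (0, 1) p)) p
    = z * (1 - z) * g2 z + (DIM((real^'n) \<times> real) - 1) / 2 * (1 - 2 * z) * g1 z"
    using radial_laplacian[where I="{a<..<cap_level \<epsilon>}" and e="(0, 1) :: (real^'n) \<times> real" and g=g and ?g1.0=g1 and ?g2.0=g2 and p=p]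
     g g1 g2 assms z by (auto simp: norm_Pair mem_cap_iff)
  then show ?thesis by (simp add: sphere_laplacian_def hom_ext_zonal)
qed

end

lemma zonal_sphere_bdry:
  assumes "g (cap_level \<epsilon>) = 0" "p \<in> sphere_bdry (cap \<epsilon>)"
  shows "zonal g p = 0"
proof -
  have "(1 - snd p) / 2 = cap_level \<epsilon>"
    using assms(2) closure_cap[of p \<epsilon>] by (fastforce simp: sphere_bdry_def mem_cap_iff)
  then show ?thesis using assms(1) by (simp add: zonal_def)
qed

section \<open>Hypergeometric series\<close>

text \<open>Coefficients of the solution of \<open>z(1-z)B'' + (n/2)(1-2z)B' + \<mu> B = 1\<close> with \<open>B(0) = 0\<close>. Then \<open>1 - \<mu> B\<close>
  solves the eigenvalue equation, and for \<open>\<mu> = 0\<close> the torsion function of \<open>{z < b}\<close> is \<open>B(b) - B\<close>.\<close>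

fun hyp_coeff :: "nat \<Rightarrow> real \<Rightarrow> nat \<Rightarrow> real" where
  "hyp_coeff n \<mu> 0 = 0"
| "hyp_coeff n \<mu> (Suc 0) = 2 / n"
| "hyp_coeff n \<mu> (Suc (Suc k)) = hyp_coeff n \<mu> (Suc k)
     * (real (Suc k) * (real (Suc k) + real n - 1) - \<mu>) / ((real (Suc k) + 1) * (real (Suc k) + real n / 2))"

definition hyp_fps :: "nat \<Rightarrow> real \<Rightarrow> real fps" where
  "hyp_fps n \<mu> = Abs_fps (hyp_coeff n \<mu>)"

text \<open>For k >= 1 and n >= 2 the factor k(k + n - 1) - \<mu> of the recurrence is at least 2 -
  \<mu>; this is why the parameter is kept at most 1.\<close>

lemma hyp_coeff_pos:
  assumes "n \<ge> 2" "\<mu> \<le> 1"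
  shows "hyp_coeff n \<mu> (Suc k) > 0"
proof (induction k)
  case (Suc k)
  have "real (Suc k) * (real (Suc k) + real n - 1) \<ge> 1 * 2" using assms by (intro mult_mono) auto
  then have "real (Suc k) * (real (Suc k) + real n - 1) - \<mu> > 0" using assms by linarith
  moreover have "(real (Suc k) + 1) * (real (Suc k) + real n / 2) > 0"
    by (intro mult_pos_pos add_pos_nonneg) auto
  ultimately show ?case unfolding hyp_coeff.simps by (intro divide_pos_pos mult_pos_pos Suc) auto
qed (use assms in auto)

text \<open>Ratio test, started at index 1 because the coefficient at 0 vanishes.\<close>

lemma fps_conv_radius_hyp:
  assumes n: "n \<ge> 2" and "\<mu> \<le> 1"
  shows "fps_conv_radius (hyp_fps n \<mu>) = 1"
  unfolding fps_conv_radius_def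
proof (rule conv_radius_ratio_limit_nonzero[where c = 1])
  have "(\<lambda>k. (real (Suc k) + 1) * (Suc k + n / 2) / (real (Suc k) * (real (Suc k) + real n - 1) - \<mu>)) \<longlonglongrightarrow> 1"
    by real_asymp
  then have "(\<lambda>k. norm (hyp_coeff n \<mu> (Suc k)) / norm (hyp_coeff n \<mu> (Suc (Suc k)))) \<longlonglongrightarrow> 1"
  proof (rule filterlim_cong[THEN iffD1, rotated -1, OF _ refl refl])
    show "\<forall>\<^sub>F k in sequentially. (real (Suc k) + 1) * (Suc k + n / 2) / (real (Suc k) * (real (Suc k) + real n - 1) - \<mu>)
       = norm (hyp_coeff n \<mu> (Suc k)) / norm (hyp_coeff n \<mu> (Suc (Suc k)))"
    proof (intro always_eventually allI)
      fix k
      have "hyp_coeff n \<mu> (Suc k) > 0" "hyp_coeff n \<mu> (Suc (Suc k)) > 0"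
        using hyp_coeff_pos[OF assms] by blast+
      then have "norm (hyp_coeff n \<mu> (Suc k)) / norm (hyp_coeff n \<mu> (Suc (Suc k)))
          = hyp_coeff n \<mu> (Suc k) / hyp_coeff n \<mu> (Suc (Suc k))" and "hyp_coeff n \<mu> (Suc k) \<noteq> 0"
        by (simp_all only: real_norm_def abs_of_pos)
      then show "(real (Suc k) + 1) * (Suc k + n / 2) / (real (Suc k) * (real (Suc k) + real n - 1) - \<mu>)
       = norm (hyp_coeff n \<mu> (Suc k)) / norm (hyp_coeff n \<mu> (Suc (Suc k)))"
        by simp
    qed
  qed
  then show "(\<lambda>k. norm (fps_nth (hyp_fps n \<mu>) k) / norm (fps_nth (hyp_fps n \<mu>) (Suc k))) \<longlonglongrightarrow> 1"
    unfolding hyp_fps_def fps_nth_Abs_fps by (rule filterlim_sequentially_Suc[THEN iffD1])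
qed auto

text \<open>Comparison of coefficients: at positive indices the equation is the recurrence, and at
  index 0 it says that n/2 times the first coefficient is 1.\<close>

lemma hyp_fps_ode:
  fixes \<mu> :: real
  assumes n: "n \<ge> 2"
  defines "B \<equiv> hyp_fps n \<mu>"
  shows "fps_X * (1 - fps_X) * fps_deriv (fps_deriv B) + fps_const (n / 2) * (1 - 2 * fps_X) * fps_deriv B
     + fps_const \<mu> * B = 1"
proof (rule fps_ext)
  fix k
  have rec: "(k + 1) * (k + n / 2) * fps_nth B (Suc k) = (k * (k + real n - 1) - \<mu>) * fps_nth B k"
    if "k > 0" for k :: nat
  proof -
    obtain j where j: "k = Suc j" using \<open>k > 0\<close> gr0_implies_Suc by auto
    have "(k + 1) * (k + n / 2) > 0" by (simp add: j add_pos_nonneg)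
    then show ?thesis unfolding B_def hyp_fps_def j by (simp add: field_simps)
  qed
  have 0: "fps_nth B 0 = 0" "fps_nth B (Suc 0) = 2 / n" by (simp_all add: B_def hyp_fps_def)
  have eq: "fps_X * (1 - fps_X) * fps_deriv (fps_deriv B) + fps_const (n / 2) * (1 - 2 * fps_X) * fps_deriv B
     + fps_const \<mu> * B
   = fps_X * (fps_deriv (fps_deriv B)) - fps_X * (fps_X * fps_deriv (fps_deriv B))
     + fps_const (n / 2) * fps_deriv B - fps_const n * (fps_X * fps_deriv B) + fps_const \<mu> * B"
    by (simp add: algebra_simps fps_const_mult[symmetric] numeral_fps_const )
  show "fps_nth (fps_X * (1 - fps_X) * fps_deriv (fps_deriv B) + fps_const (n / 2) * (1 - 2 * fps_X) * fps_deriv B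
     + fps_const \<mu> * B) k = fps_nth 1 k"
    unfolding eq
  proof (cases k)
    case 0
    then show "fps_nth (fps_X * (fps_deriv (fps_deriv B)) - fps_X * (fps_X * fps_deriv (fps_deriv B))
     + fps_const (n / 2) * fps_deriv B - fps_const n * (fps_X * fps_deriv B) + fps_const \<mu> * B) k = fps_nth 1 k"
      using n \<open>fps_nth B 0 = 0\<close> \<open>fps_nth B (Suc 0) = 2 / n\<close> by simp
  next
    case (Suc m)
    then show "fps_nth (fps_X * (fps_deriv (fps_deriv B)) - fps_X * (fps_X * fps_deriv (fps_deriv B))
     + fps_const (n / 2) * fps_deriv B - fps_const n * (fps_X * fps_deriv B) + fps_const \<mu> * B) k = fps_nth 1 k"
      using rec[of k] by (cases m) (simp_all add: algebra_simps add_divide_distrib)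
  qed
qed

section \<open>The series as functions and the differential equation they satisfy\<close>

definition hyp :: "nat \<Rightarrow> real \<Rightarrow> real \<Rightarrow> real" where
  "hyp n \<mu> = eval_fps (hyp_fps n \<mu>)"

definition hyp1 :: "nat \<Rightarrow> real \<Rightarrow> real \<Rightarrow> real" where
  "hyp1 n \<mu> = eval_fps (fps_deriv (hyp_fps n \<mu>))"

definition hyp2 :: "nat \<Rightarrow> real \<Rightarrow> real \<Rightarrow> real" where
  "hyp2 n \<mu> = eval_fps (fps_deriv (fps_deriv (hyp_fps n \<mu>)))"

lemma fps_conv_radius_hyp_deriv:
  assumes "n \<ge> 2" "\<mu> \<le> 1"
  shows "fps_conv_radius (fps_deriv (hyp_fps n \<mu>)) \<ge> 1"
    "fps_conv_radius (fps_deriv (fps_deriv (hyp_fps n \<mu>))) \<ge> 1"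
  using fps_conv_radius_deriv[of "hyp_fps n \<mu>"] fps_conv_radius_deriv[of "fps_deriv (hyp_fps n \<mu>)"]
  unfolding fps_conv_radius_hyp[OF assms] by (auto intro: order_trans)

lemma
  fixes \<mu> z :: real
  assumes "n \<ge> 2" "\<mu> \<le> 1" "\<bar>z\<bar> < 1"
  shows hyp_deriv: "(hyp n \<mu> has_field_derivative hyp1 n \<mu> z) (at z)"
    and hyp1_deriv: "(hyp1 n \<mu> has_field_derivative hyp2 n \<mu> z) (at z)"
    and hyp2_cont: "isCont (hyp2 n \<mu>) z"
    and hyp_sums: "(\<lambda>k. hyp_coeff n \<mu> k * z ^ k) sums hyp n \<mu> z"
    and hyp_ode: "z * (1 - z) * hyp2 n \<mu> z + n / 2 * (1 - 2 * z) * hyp1 n \<mu> z + \<mu> * hyp n \<mu> z = 1"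
proof -
  have z: "ereal (norm z) < 1" using assms by simp
  have r: "ereal (norm z) < fps_conv_radius (hyp_fps n \<mu>)"
    "ereal (norm z) < fps_conv_radius (fps_deriv (hyp_fps n \<mu>))"
    "ereal (norm z) < fps_conv_radius (fps_deriv (fps_deriv (hyp_fps n \<mu>)))"
    using fps_conv_radius_hyp[OF assms(1,2)] z
      less_le_trans[OF z fps_conv_radius_hyp_deriv(1)[OF assms(1,2)]]
      less_le_trans[OF z fps_conv_radius_hyp_deriv(2)[OF assms(1,2)]] by auto
  show "(hyp n \<mu> has_field_derivative hyp1 n \<mu> z) (at z)"
    "(hyp1 n \<mu> has_field_derivative hyp2 n \<mu> z) (at z)"
    unfolding hyp_def hyp1_def hyp2_def by (intro has_field_derivative_eval_fps r)+
  show "isCont (hyp2 n \<mu>) z"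
    unfolding hyp2_def using has_field_derivative_eval_fps[OF r(3)] DERIV_isCont by blast
  show "(\<lambda>k. hyp_coeff n \<mu> k * z ^ k) sums hyp n \<mu> z"
    using sums_eval_fps[OF r(1)] by (simp add: hyp_def hyp_fps_def)
  \<comment> \<open>Evaluation is multiplicative inside the radii of both factors; the polynomial
    factors have infinite radius, so only the series restricts \<open>z\<close>.\<close>
  have X: "fps_conv_radius (1 - fps_X :: real fps) = \<infinity>" "fps_conv_radius (1 - 2 * fps_X :: real fps) = \<infinity>"
    using fps_conv_radius_diff[of "1 :: real fps" "fps_X"] fps_conv_radius_diff[of "1 :: real fps" "2 * fps_X"]
      fps_conv_radius_mult[of "2 :: real fps" "fps_X"] by (simp_all add: top_ereal_def[symmetric] top_unique)
  have XX: "fps_conv_radius (fps_X * (1 - fps_X) :: real fps) = \<infinity>"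
    "fps_conv_radius (fps_const (n / 2) * (1 - 2 * fps_X) :: real fps) = \<infinity>"
    using fps_conv_radius_mult[of "fps_X :: real fps" "1 - fps_X"]
      fps_conv_radius_mult[of "fps_const (n / 2) :: real fps" "1 - 2 * fps_X"] X
    by (simp_all add: top_ereal_def[symmetric] top_unique)
  define P Q R where "P = fps_X * (1 - fps_X) * fps_deriv (fps_deriv (hyp_fps n \<mu>))"
    and "Q = fps_const (n / 2) * (1 - 2 * fps_X) * fps_deriv (hyp_fps n \<mu>)"
    and "R = fps_const \<mu> * hyp_fps n \<mu>"
  have rad: "ereal (norm z) < fps_conv_radius P" "ereal (norm z) < fps_conv_radius Q"
    "ereal (norm z) < fps_conv_radius R"
    unfolding P_def Q_def R_def
    by (rule less_le_trans[OF _ fps_conv_radius_mult]; use r X XX in simp)+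
  have "eval_fps (P + Q + R) z = 1"
    unfolding P_def Q_def R_def by (simp add: hyp_fps_ode assms)
  moreover have "eval_fps (P + Q + R) z = eval_fps P z + eval_fps Q z + eval_fps R z"
    using rad less_le_trans[OF _ fps_conv_radius_add, of "ereal (norm z)" P Q]
    by (simp add: eval_fps_add)
  moreover have "eval_fps (2 * fps_X :: real fps) z = 2 * z"
    by (subst eval_fps_mult) (auto simp: fps_conv_radius_numeral)
  ultimately show "z * (1 - z) * hyp2 n \<mu> z + n / 2 * (1 - 2 * z) * hyp1 n \<mu> z + \<mu> * hyp n \<mu> z = 1"
    using r X XX fps_conv_radius_mult[of "2 :: real fps" "fps_X"]
    by (simp add: P_def Q_def R_def eval_fps_mult eval_fps_diff hyp_def hyp1_def hyp2_def)
qed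

text \<open>Raising the parameter from 0 shrinks the factors of the recurrence, which stay
  nonnegative. The bound serves as a majorant uniform in \<open>\<mu>\<close>.\<close>

lemma hyp_coeff_le:
  assumes n: "n \<ge> 2" and "0 \<le> \<mu>" "\<mu> \<le> 1"
  shows "hyp_coeff n \<mu> k \<le> hyp_coeff n 0 k"
proof (induction k)
  case (Suc k)
  show ?case
  proof (cases k)
    case (Suc j)
    have "real (Suc j) * (real (Suc j) + real n - 1) \<ge> 1 * 2" using assms by (intro mult_mono) auto
    then have "\<mu> \<le> real (Suc j) * (real (Suc j) + real n - 1)" using assms by linarith
    moreover have "0 < hyp_coeff n \<mu> k" using hyp_coeff_pos[of n \<mu> j] assms Suc by simp
    ultimately show ?thesis using Suc.IH assms
      by (auto simp: Suc simp del: of_nat_Suc intro!: divide_right_mono mult_mono mult_nonneg_nonneg)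
  qed simp
qed simp

text \<open>The ratio of the coefficients is a product of factors \<open>1 - \<mu>/(j(j+n-1))\<close>, and \<open>1/(j(j+n-1))\<close> is at
  most \<open>1/j - 1/(j+1)\<close>, which telescopes.\<close>

lemma hyp_coeff_ge:
  assumes n: "n \<ge> 2" and \<mu>: "0 \<le> \<mu>" "\<mu> \<le> 1"
  shows "hyp_coeff n \<mu> (Suc k) \<ge> (1 - \<mu> * (1 - 1 / Suc k)) * hyp_coeff n 0 (Suc k)"
proof (induction k)
  case (Suc k)
  define c where "c = hyp_coeff n 0 (Suc k)"
  define q where "q = real (Suc k) * (real (Suc k) + real n - 1)"
  define d where "d = (real (Suc k) + 1) * (real (Suc k) + real n / 2)"
  have c: "c > 0" using hyp_coeff_pos[of n 0 k] n by (simp add: c_def)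
  have qd: "q > 0" "d > 0" "q \<ge> real (Suc k) * real (Suc (Suc k))" using n
    by (auto simp: q_def d_def mult_left_mono intro!: mult_pos_pos add_pos_pos)
  have 0: "q - \<mu> \<ge> 0"
  proof -
    have "1 * 1 \<le> real (Suc k) * real (Suc (Suc k))" by (intro mult_mono) auto
    then show ?thesis using qd \<mu> by linarith
  qed
  define t where "t = 1 - \<mu> * (1 - 1 / Suc k)"
  have t: "t \<le> 1" using \<mu> by (simp add: t_def)
  have "(1 - \<mu> * (1 - 1 / Suc (Suc k))) * q = t * q - \<mu> * (q / (real (Suc k) * real (Suc (Suc k))))"
    by (simp add: t_def divide_simps) (simp add: algebra_simps)
  also have "\<dots> \<le> t * q - \<mu> * 1"
    using qd \<mu> by (intro diff_left_mono mult_left_mono) (auto simp del: of_nat_Suc)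
  also have "\<dots> \<le> t * q - \<mu> * t" using \<mu> t by (simp add: mult_left_le)
  finally have "(1 - \<mu> * (1 - 1 / Suc (Suc k))) * q \<le> t * (q - \<mu>)" by (simp add: algebra_simps)
  then have "(1 - \<mu> * (1 - 1 / Suc (Suc k))) * q * (c / d) \<le> t * (q - \<mu>) * (c / d)"
    using c qd by (intro mult_right_mono) auto
  also have "\<dots> = t * c * ((q - \<mu>) / d)" by simp
  also have "\<dots> \<le> hyp_coeff n \<mu> (Suc k) * ((q - \<mu>) / d)"
    using Suc.IH 0 qd by (intro mult_right_mono) (auto simp: c_def t_def)
  finally show ?case by (simp add: c_def q_def d_def mult_ac)
qed auto

text \<open>Because n - 1 >= n/2 for n >= 2, each factor of the recurrence is at least k/(k + 1),
  and the product of these telescopes.\<close>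

lemma hyp_coeff_0_ge:
  assumes n: "n \<ge> 2"
  shows "hyp_coeff n 0 (Suc k) \<ge> 2 / n * (1 / Suc k)"
proof (induction k)
  case (Suc k)
  define d where "d = (real (Suc k) + 1) * (real (Suc k) + real n / 2)"
  have d: "d > 0" by (auto simp: d_def intro!: mult_pos_pos add_pos_nonneg)
  have "2 / n * (1 / Suc (Suc k)) = 2 / n * (1 / Suc k) * (real (Suc k) * (real (Suc k) + n / 2) / d)"
    by (simp add: d_def divide_simps)
  also have "\<dots> \<le> 2 / n * (1 / Suc k) * (real (Suc k) * (real (Suc k) + real n - 1) / d)"
    using d n by (intro mult_left_mono divide_right_mono) (auto simp: field_simps)
  also have "\<dots> \<le> hyp_coeff n 0 (Suc k) * (real (Suc k) * (real (Suc k) + real n - 1) / d)"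
    using Suc d n by (intro mult_right_mono divide_nonneg_nonneg mult_nonneg_nonneg) auto
  finally show ?case by (simp add: d_def)
qed auto

text \<open>Termwise comparison with the logarithmic series; it makes the maximum of the torsion
  function diverge as the cap fills the sphere.\<close>

lemma hyp_ge_ln:
  assumes "n \<ge> 2" "0 < z" "z < 1"
  shows "hyp n 0 z \<ge> - 2 / n * ln (1 - z)"
proof -
  have "(\<lambda>k. 2 / n * (z ^ Suc k / Suc k)) sums (2 / n * (- ln (1 - z)))"
  proof (intro sums_mult)
    have "(\<lambda>k. z ^ k / k) sums (- ln (1 - z))"
      using sums_minus[OF ln_series'[of "- z"]] assms by simp
    then show "(\<lambda>k. z ^ Suc k / Suc k) sums (- ln (1 - z))"
      by (subst sums_Suc_iff) auto
  qed
  moreover have "(\<lambda>k. hyp_coeff n 0 (Suc k) * z ^ Suc k) sums hyp n 0 z"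
    using hyp_sums[of n 0 z] assms by (subst sums_Suc_iff) auto
  ultimately have "2 / n * (- ln (1 - z)) \<le> hyp n 0 z"
  proof (rule sums_le[rotated])
    show "2 / n * (z ^ Suc k / Suc k) \<le> hyp_coeff n 0 (Suc k) * z ^ Suc k" for k
      using mult_right_mono[OF hyp_coeff_0_ge[OF assms(1), of k], of "z ^ Suc k"] assms by simp
  qed
  then show ?thesis by simp
qed

lemma hyp_ge:
  assumes "n \<ge> 2" "0 < z" "z < 1" "0 \<le> \<mu>" "\<mu> \<le> 1"
  shows "(1 - \<mu>) * hyp n 0 z \<le> hyp n \<mu> z"
proof (rule sums_le)
  show "(\<lambda>k. (1 - \<mu>) * (hyp_coeff n 0 k * z ^ k)) sums ((1 - \<mu>) * hyp n 0 z)"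
    using hyp_sums[of n 0 z] assms by (intro sums_mult) auto
  show "(\<lambda>k. hyp_coeff n \<mu> k * z ^ k) sums hyp n \<mu> z" using hyp_sums assms by auto
  fix k
  show "(1 - \<mu>) * (hyp_coeff n 0 k * z ^ k) \<le> hyp_coeff n \<mu> k * z ^ k"
  proof (cases k)
    case (Suc j)
    have "(1 - \<mu>) * hyp_coeff n 0 (Suc j) \<le> (1 - \<mu> * (1 - 1 / Suc j)) * hyp_coeff n 0 (Suc j)"
      using hyp_coeff_pos[of n 0 j] assms by (intro mult_right_mono) (auto simp: field_simps)
    also note hyp_coeff_ge[OF assms(1,4,5), of j]
    finally show ?thesis using assms Suc by (simp add: mult.assoc[symmetric] mult_right_mono del: power_Suc)
  qed simp
qed

text \<open>Each coefficient is continuous in \<open>\<mu>\<close>, and the series at parameter 0 is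
  a majorant for the Weierstrass test.\<close>

lemma hyp_continuous_parameter:
  assumes "n \<ge> 2" "0 < z" "z < 1"
  shows "continuous_on {0..1} (\<lambda>\<mu>. hyp n \<mu> z)"
proof -
  have cc: "continuous_on {0..1} (\<lambda>\<mu>. hyp_coeff n \<mu> k)" for k
  proof (induction k)
    case (Suc k)
    show ?case
    proof (cases k)
      case (Suc j)
      have "(real (Suc j) + 1) * (real (Suc j) + real n / 2) \<noteq> 0" by (simp add: add_nonneg_eq_0_iff)
      then show ?thesis using Suc.IH unfolding Suc hyp_coeff.simps by (intro continuous_intros) auto
    qed simp
  qed simp
  have "uniform_limit {0..1} (\<lambda>m \<mu>. \<Sum>k<m. hyp_coeff n \<mu> k * z ^ k) (\<lambda>\<mu>. \<Sum>k. hyp_coeff n \<mu> k * z ^ k) sequentially"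
  proof (rule Weierstrass_m_test)
    show "summable (\<lambda>k. hyp_coeff n 0 k * z ^ k)" using hyp_sums[of n 0 z] assms by (auto simp: sums_iff)
    fix k and \<mu> :: real
    assume "\<mu> \<in> {0..1}"
    then have "0 \<le> hyp_coeff n \<mu> k" "hyp_coeff n \<mu> k \<le> hyp_coeff n 0 k"
      using hyp_coeff_le[OF assms(1)] hyp_coeff_pos[OF assms(1), of \<mu> "k - 1"] by (cases k; auto)+
    then show "norm (hyp_coeff n \<mu> k * z ^ k) \<le> hyp_coeff n 0 k * z ^ k"
      using assms by (simp add: abs_mult mult_right_mono)
  qed
  then have "continuous_on {0..1} (\<lambda>\<mu>. \<Sum>k. hyp_coeff n \<mu> k * z ^ k)"
    by (rule uniform_limit_theorem[rotated]) (auto intro!: always_eventually continuous_intros cc)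
  then show ?thesis
    by (rule continuous_on_eq) (use hyp_sums assms in \<open>auto simp: sums_iff\<close>)
qed

text \<open>The condition on \<open>\<mu>\<close> says that the profile
  \<open>1 - \<mu> * hyp n \<mu>\<close> vanishes at \<open>z\<close>. It is found by the
  intermediate value theorem, as \<open>\<mu> * hyp n \<mu> z\<close> is 0 at
  \<open>\<mu> = 0\<close> and at least 1 at \<open>\<mu>0\<close>.\<close>

lemma hyp_eigenvalue_exists:
  fixes S :: real
  assumes "n \<ge> 2" "0 < z" "z < 1"
  defines "S \<equiv> hyp n 0 z"
  assumes S: "S \<ge> 5"
  obtains \<mu> where "0 < \<mu>" "\<mu> \<le> 1" "\<mu> \<le> (1 + 2 / S) / S" "\<mu> * hyp n \<mu> z = 1"
proof -
  \<comment> \<open>By \<open>hyp_ge\<close> it suffices that \<mu>0 (1 - \<mu>0) S >= 1. For this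
    value the excess over 1 is (S^2 - 4S - 4)/S^3, which is nonnegative once S >= 5.\<close>
  define \<mu>0 where "\<mu>0 = (1 + 2 / S) / S"
  have \<mu>0: "0 < \<mu>0" "\<mu>0 \<le> 1" using S mult_right_mono[of 5 S S]
    by (auto simp: \<mu>0_def field_simps intro!: add_pos_pos order_trans[of "S + 2" "5 * S" "S * S"])
  have "1 \<le> \<mu>0 * ((1 - \<mu>0) * S)"
  proof -
    have "\<mu>0 * ((1 - \<mu>0) * S) = 1 + (S * S - 4 * S - 4) / S ^ 3"
      using S by (simp add: \<mu>0_def field_simps eval_nat_numeral)
    moreover have "S * S - 4 * S - 4 \<ge> 0" using S mult_right_mono[of 5 S S] by linarith
    ultimately show ?thesis using S by simp
  qed
  also have "\<dots> \<le> \<mu>0 * hyp n \<mu>0 z"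
    unfolding S_def using hyp_ge assms \<mu>0 by (intro mult_left_mono) auto
  finally have ge: "1 \<le> \<mu>0 * hyp n \<mu>0 z" .
  have "continuous_on {0..\<mu>0} (\<lambda>\<mu>. \<mu> * hyp n \<mu> z)"
    using \<mu>0 by (intro continuous_intros continuous_on_subset[OF hyp_continuous_parameter[OF assms(1-3)]]) auto
  then obtain \<mu> where "0 \<le> \<mu>" "\<mu> \<le> \<mu>0" "\<mu> * hyp n \<mu> z = 1"
    using IVT'[of "\<lambda>\<mu>. \<mu> * hyp n \<mu> z" 0 1 \<mu>0] ge \<mu>0 by auto
  moreover then have "\<mu> \<noteq> 0" by auto
  ultimately show ?thesis using that[of \<mu>] \<mu>0 by (auto simp: \<mu>0_def)
qed

section \<open>The radial Green operator\<close>

text \<open>The equation \<open>(w g')' = - m h\<close> with \<open>w = (z(1-z))\<^bsup>n/2\<^esup>\<close> and \<open>m = w/(z(1-z))\<close> is singular at \<open>z = 0\<close>.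
  Substituting \<open>x = z r\<^sup>2\<close> in the integral of \<open>m h\<close> over \<open>[0, z]\<close> removes the singularity and makes
  sense for \<open>z < 0\<close> too, which gives the zonal solution its regularity at the pole. In terms of
  \<open>slope\<close> below the equation becomes \<open>g' = - slope n h\<close>.\<close>

definition avg :: "nat \<Rightarrow> (real \<Rightarrow> real) \<Rightarrow> real \<Rightarrow> real" where
  "avg n H z = integral {0..1} (\<lambda>r. 2 * r ^ (n - 1) * H (z * r\<^sup>2))"

section \<open>Weighted averages and their first-order singular equation\<close>

lemma mult_square_mem_convex:
  fixes J :: "real set"
  assumes "convex J" "0 \<in> J" "z \<in> J" "r \<in> {0..1}"
  shows "z * r\<^sup>2 \<in> J"
proof -
  have "r\<^sup>2 \<le> 1" using assms by (simp add: power_le_one)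
  then have "(1 - r\<^sup>2) *\<^sub>R 0 + r\<^sup>2 *\<^sub>R z \<in> J" using assms by (intro convexD) auto
  then show ?thesis by (simp add: mult.commute)
qed

context
  fixes J :: "real set"
  assumes J: "convex J" "0 \<in> J"
begin

lemma avg_integrand_continuous:
  assumes "continuous_on J H"
  shows "continuous_on (J \<times> cbox 0 1) (\<lambda>(z, r). 2 * r ^ (n - 1) * H (z * r\<^sup>2))"
  unfolding split_beta using mult_square_mem_convex[OF J]
  by (intro continuous_intros continuous_on_compose2[OF assms]) auto

lemma avg_integrable:
  assumes "continuous_on J H" "z \<in> J"
  shows "(\<lambda>r. 2 * r ^ (n - 1) * H (z * r\<^sup>2)) integrable_on {0..1}"
  using mult_square_mem_convex[OF J] assms(2)
  by (intro integrable_continuous_interval continuous_intros continuous_on_compose2[OF assms(1)]) auto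

lemma avg_continuous:
  assumes "continuous_on J H"
  shows "continuous_on J (avg n H)"
  using integral_continuous_on_param[OF avg_integrand_continuous[OF assms, of n]]
  by (simp add: avg_def[abs_def])

lemma avg_mono:
  assumes "continuous_on J H" "continuous_on J H'" "\<And>x. x \<in> J \<Longrightarrow> H x \<le> H' x" "z \<in> J"
  shows "avg n H z \<le> avg n H' z"
  unfolding avg_def
  by (intro integral_le avg_integrable mult_left_mono assms) (use assms mult_square_mem_convex[OF J] in auto)

lemma avg_add_scaled:
  assumes "continuous_on J H" "continuous_on J H'" "z \<in> J"
  shows "avg n (\<lambda>x. H x + c * H' x) z = avg n H z + c * avg n H' z"
proof -
  have "avg n (\<lambda>x. H x + c * H' x) z
    = integral {0..1} (\<lambda>r. 2 * r ^ (n - 1) * H (z * r\<^sup>2) + c * (2 * r ^ (n - 1) * H' (z * r\<^sup>2)))"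
    unfolding avg_def by (intro integral_cong) (simp add: algebra_simps)
  also have "\<dots> = avg n H z + c * avg n H' z"
    unfolding avg_def using assms
    by (subst integral_add) (auto intro!: avg_integrable[simplified] integrable_on_mult_right)
  finally show ?thesis .
qed

text \<open>Differentiation under the integral produces a factor r^2, which raises the index by 2.
  The equation comes from integrating the r-derivative of r^n H(z r^2) over [0, 1]; the term at r =
  0 vanishes as n >= 1.\<close>

lemma
  assumes "open J" "n \<ge> 1" and H: "\<And>x. x \<in> J \<Longrightarrow> (H has_field_derivative H' x) (at x)"
    and H': "continuous_on J H'" and z: "z \<in> J"
  shows avg_deriv: "(avg n H has_field_derivative avg (n + 2) H' z) (at z)"
    and avg_ode: "z * avg (n + 2) H' z + n / 2 * avg n H z = H z"
proof -
  have cH: "continuous_on J H" using H DERIV_continuous_on has_field_derivative_at_within by blast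
  have eq: "avg (n + 2) H' x = integral {0..1} (\<lambda>r. 2 * r ^ (n - 1) * (H' (x * r\<^sup>2) * r\<^sup>2))" for x
    unfolding avg_def using \<open>n \<ge> 1\<close>
    by (intro integral_cong) (cases n; simp add: power2_eq_square)
  have d: "((\<lambda>x. H (x * r\<^sup>2)) has_field_derivative H' (x * r\<^sup>2) * r\<^sup>2) (at x within S)"
    if "x \<in> J" "r \<in> {0..1}" for x r S
    by (rule DERIV_chain2[where f = H and g = "\<lambda>x. x * r\<^sup>2", OF H[OF mult_square_mem_convex[OF J that]]]) (auto intro!: derivative_eq_intros)
  have "((\<lambda>x. integral (cbox 0 1) (\<lambda>r. 2 * r ^ (n - 1) * H (x * r\<^sup>2))) has_field_derivative
      integral (cbox 0 1) (\<lambda>r. 2 * r ^ (n - 1) * (H' (z * r\<^sup>2) * r\<^sup>2))) (at z within J)"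
  proof (rule leibniz_rule_field_derivative[OF _ _ _ z J(1)])
    show "continuous_on (J \<times> cbox 0 1) (\<lambda>(x, r). 2 * r ^ (n - 1) * (H' (x * r\<^sup>2) * r\<^sup>2))"
      unfolding split_beta using mult_square_mem_convex[OF J]
      by (intro continuous_intros continuous_on_compose2[OF H']) auto
  next
    fix x r :: real assume "x \<in> J" "r \<in> cbox 0 1"
    then show "((\<lambda>x. 2 * r ^ (n - 1) * H (x * r\<^sup>2)) has_field_derivative
        2 * r ^ (n - 1) * (H' (x * r\<^sup>2) * r\<^sup>2)) (at x within J)"
      by (intro DERIV_cmult d) auto
  next
    show "(\<lambda>r. 2 * r ^ (n - 1) * H (x * r\<^sup>2)) integrable_on cbox 0 1" if "x \<in> J" for x
      using avg_integrable[OF cH that] by simp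
  qed
  moreover have "avg n H = (\<lambda>x. integral (cbox 0 1) (\<lambda>r. 2 * r ^ (n - 1) * H (x * r\<^sup>2)))"
    by (simp add: avg_def fun_eq_iff)
  ultimately show "(avg n H has_field_derivative avg (n + 2) H' z) (at z)"
    unfolding eq at_within_open[OF z \<open>open J\<close>] by simp
  define k where "k r = H (z * r\<^sup>2)" for r
  define k' where "k' r = H' (z * r\<^sup>2) * (z * (2 * r))" for r
  have k: "(k has_field_derivative k' r) (at r within {0..1})" if "r \<in> {0..1}" for r
    unfolding k_def[abs_def] k'_def
    by (rule DERIV_chain2[where f = H and g = "\<lambda>r. z * r\<^sup>2", OF H[OF mult_square_mem_convex[OF J z that]]])
       (auto intro!: derivative_eq_intros)
  have "((\<lambda>r. real n * r ^ (n - 1) * k r + r ^ n * k' r) has_integral (1 ^ n * k 1 - 0 ^ n * k 0)) {0..1}"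
  proof (rule fundamental_theorem_of_calculus)
    fix r :: real assume r: "r \<in> {0..1}"
    have "((\<lambda>r. r ^ n) has_field_derivative real n * r ^ (n - 1)) (at r within {0..1})"
      using DERIV_pow[of n r] by simp
    from DERIV_mult[OF this k[OF r]]
    show "((\<lambda>r. r ^ n * k r) has_vector_derivative (real n * r ^ (n - 1) * k r + r ^ n * k' r)) (at r within {0..1})"
      unfolding has_real_derivative_iff_has_vector_derivative[symmetric] by (simp add: mult.commute)
  qed simp
  then have 1: "((\<lambda>r. real n * r ^ (n - 1) * k r + r ^ n * k' r) has_integral H z) {0..1}"
    using \<open>n \<ge> 1\<close> by (simp add: k_def zero_power)
  have "((\<lambda>r. real n / 2 * (2 * r ^ (n - 1) * H (z * r\<^sup>2)) + z * (2 * r ^ (n + 2 - 1) * H' (z * r\<^sup>2)))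
     has_integral (real n / 2 * avg n H z + z * avg (n + 2) H' z)) {0..1}"
    unfolding avg_def
    by (intro has_integral_add has_integral_mult_right integrable_integral avg_integrable cH H' z)
  then have 2: "((\<lambda>r. real n * r ^ (n - 1) * k r + r ^ n * k' r)
     has_integral (real n / 2 * avg n H z + z * avg (n + 2) H' z)) {0..1}"
  proof (rule has_integral_eq[rotated])
    fix r :: real
    have "real n / 2 * (2 * a * h) + z * (2 * (r * b) * h') = real n * a * h + b * (h' * (z * (2 * r)))"
      for a h b h' :: real by (simp add: algebra_simps)
    moreover have "n + 2 - 1 = Suc n" by simp
    ultimately show "real n / 2 * (2 * r ^ (n - 1) * H (z * r\<^sup>2)) + z * (2 * r ^ (n + 2 - 1) * H' (z * r\<^sup>2))
      = real n * r ^ (n - 1) * k r + r ^ n * k' r"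
      by (simp only: power_Suc k_def k'_def)
  qed
  have "real n / 2 * avg n H z + z * avg (n + 2) H' z = H z"
    by (rule has_integral_unique[OF 2 1])
  then show "z * avg (n + 2) H' z + n / 2 * avg n H z = H z" by (simp add: add.commute)
qed

end

text \<open>The difference \<open>d\<close> of the two solutions satisfies \<open>(x\<^sup>n d\<^sup>2)' = 0\<close>.\<close>

lemma singular_ode_unique:
  fixes p q :: "real \<Rightarrow> real"
  assumes J: "convex J" "0 \<in> J" "open J" and n: "n \<ge> 1"
    and p: "\<And>x. x \<in> J \<Longrightarrow> (p has_field_derivative p' x) (at x)"
    and q: "\<And>x. x \<in> J \<Longrightarrow> (q has_field_derivative q' x) (at x)"
    and eq: "\<And>x. x \<in> J \<Longrightarrow> x * p' x + real n / 2 * p x = x * q' x + real n / 2 * q x"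
    and z: "z \<in> J"
  shows "p z = q z"
proof (cases "z = 0")
  \<comment> \<open>At the singular point the derivative terms drop out of the equation, which then
    determines the value.\<close>
  case True
  then show ?thesis using eq[OF z] n by simp
next
  case False
  have "((\<lambda>x. x ^ n * (p x - q x)\<^sup>2) has_field_derivative 0) (at x within J)" if x: "x \<in> J" for x
  proof -
    have "((\<lambda>x. x ^ n * (p x - q x)\<^sup>2) has_field_derivative
        n * x ^ (n - 1) * (p x - q x)\<^sup>2 + x ^ n * (2 * (p x - q x) * (p' x - q' x))) (at x)"
      by (auto intro!: derivative_eq_intros p q x)
    moreover have "n * x ^ (n - 1) * (p x - q x)\<^sup>2 + x ^ n * (2 * (p x - q x) * (p' x - q' x))
      = 2 * x ^ (n - 1) * (p x - q x) * ((x * p' x + n / 2 * p x) - (x * q' x + n / 2 * q x))"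
      using n by (cases n) (auto simp: power2_eq_square field_simps)
    ultimately show ?thesis using eq[OF x] by (simp add: has_field_derivative_at_within)
  qed
  from has_field_derivative_zero_constant[OF J(1) this]
  obtain c where c: "\<And>x. x \<in> J \<Longrightarrow> x ^ n * (p x - q x)\<^sup>2 = c" by blast
  \<comment> \<open>Evaluation at the singular point 0, where x^n vanishes.\<close>
  have "c = 0" using c[OF J(2)] n by (simp add: zero_power)
  then show ?thesis using c[OF z] False by simp
qed

text \<open>This is the factor of m depending on 1 - x. For z > 0 the substitution x = z r^2
  extracts z^(n/2) from the integral of m h, cancelling the same power in w; what remains of the
  quotient by w is \<open>slope\<close>.\<close>

definition wt :: "nat \<Rightarrow> real \<Rightarrow> real" where
  "wt n x = (1 - x) powr (real n / 2 - 1)"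

definition slope :: "nat \<Rightarrow> (real \<Rightarrow> real) \<Rightarrow> real \<Rightarrow> real" where
  "slope n h z = (1 - z) powr (- (real n / 2)) * avg n (\<lambda>x. wt n x * h x) z"

lemma wt_nonneg: "wt n x \<ge> 0" by (simp add: wt_def)

lemma wt_continuous: "J \<subseteq> {..<1} \<Longrightarrow> continuous_on J (wt n)"
  unfolding wt_def[abs_def] by (intro continuous_intros) auto

text \<open>\<open>avg_ode\<close> applied to \<open>wt n x * h x\<close> becomes the stated
  equation, since the powers of 1 - z cancel. The formula for the derivative is regular at 0, so a
  C1 right-hand side yields a C2 profile across the pole.\<close>

lemma slope_C1:
  assumes J: "convex J" "0 \<in> J" "open J" "J \<subseteq> {..<1}" and n: "n \<ge> 2"
    and h: "\<And>x. x \<in> J \<Longrightarrow> (h has_field_derivative h' x) (at x)" "continuous_on J h'"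
  shows "\<exists>s'. continuous_on J s' \<and> (\<forall>z\<in>J. (slope n h has_field_derivative s' z) (at z) \<and>
     z * (1 - z) * s' z + n / 2 * (1 - 2 * z) * slope n h z = h z)"
proof -
  define H where "H x = wt n x * h x" for x
  define w' where "w' x = (1 - n / 2) * (1 - x) powr (n / 2 - 2)" for x :: real
  define H' where "H' x = w' x * h x + wt n x * h' x" for x
  have ch: "continuous_on J h" using h DERIV_continuous_on has_field_derivative_at_within by blast
  have H: "(H has_field_derivative H' x) (at x)" if "x \<in> J" for x
  proof -
    have "(wt n has_field_derivative w' x) (at x)"
      unfolding wt_def[abs_def] w'_def using that J(4)
      by (auto intro!: derivative_eq_intros simp: subset_eq algebra_simps)
    then show ?thesis unfolding H_def[abs_def] H'_def using h(1)[OF that] by (auto intro!: derivative_eq_intros)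
  qed
  have cw': "continuous_on J w'" unfolding w'_def using J(4) by (intro continuous_intros) auto
  have cH': "continuous_on J H'" unfolding H'_def by (intro continuous_intros cw' ch h wt_continuous J(4))
  have n1: "n \<ge> 1" using n by simp
  have P: "(avg n H has_field_derivative avg (n + 2) H' z) (at z)"
    and ode: "z * avg (n + 2) H' z + n / 2 * avg n H z = H z" if "z \<in> J" for z
    by (rule avg_deriv[OF J(1-3) n1 _ cH' that] avg_ode[OF J(1-3) n1 _ cH' that], erule H)+
  define s' where "s' z = n / 2 * (1 - z) powr (- (real n / 2) - 1) * avg n H z + (1 - z) powr (- (real n / 2)) * avg (n + 2) H' z" for z
  show ?thesis
  proof (intro exI[of _ s'] conjI ballI)
    have "continuous_on J (avg n H)" using P DERIV_continuous_on has_field_derivative_at_within by blast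
    then show "continuous_on J s'" unfolding s'_def using J(4) 
      by (intro continuous_intros avg_continuous[OF J(1,2) cH']) auto
  next
    fix z assume z: "z \<in> J"
    then have z1: "z < 1" using J(4) by auto
    have slope: "slope n h z = (1 - z) powr (- (real n / 2)) * avg n H z" for z
      by (simp add: slope_def H_def[abs_def])
    have "((\<lambda>z. (1 - z) powr (- (real n / 2)) * avg n H z) has_field_derivative s' z) (at z)"
      unfolding s'_def using z1 by (auto intro!: derivative_eq_intros P[OF z])
    then show "(slope n h has_field_derivative s' z) (at z)" unfolding slope .
    define D where "D = (1 - z) powr (- (real n / 2))"
    have D: "(1 - z) powr (- (real n / 2) - 1) = D / (1 - z)" using z1 by (simp add: D_def powr_diff)
    have "z * (1 - z) * s' z + n / 2 * (1 - 2 * z) * slope n h z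
       = D * (1 - z) * (z * avg (n + 2) H' z + n / 2 * avg n H z)"
      using z1 unfolding s'_def slope D D_def[symmetric] by (simp add: field_simps)
    also have "\<dots> = D * (1 - z) * H z" by (simp only: ode[OF z])
    also have "D * (1 - z) = (1 - z) powr (- (real n / 2) + 1)" using z1 by (subst powr_add) (simp add: D_def)
    also have "\<dots> * H z = (1 - z) powr ((- (real n / 2) + 1) + (real n / 2 - 1)) * h z" 
      by (simp only: H_def wt_def powr_add mult.assoc)
    also have "\<dots> = h z" using z1 by simp
    finally show "z * (1 - z) * s' z + n / 2 * (1 - 2 * z) * slope n h z = h z" .
  qed
qed

text \<open>Both sides solve the same singular equation and are regular at 0, so uniqueness
  identifies them; this ties the Green operator to the hypergeometric series.\<close>

lemma slope_1:
  assumes n: "n \<ge> 2" and z: "\<bar>z\<bar> < 1"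
  shows "slope n (\<lambda>_. 1) z = hyp1 n 0 z"
proof -
  define J where "J = {-1<..<1::real}"
  have J: "convex J" "0 \<in> J" "open J" "J \<subseteq> {..<1}" by (auto simp: J_def)
  obtain s' where s': "\<And>z. z \<in> J \<Longrightarrow> (slope n (\<lambda>_. 1) has_field_derivative s' z) (at z)"
     "\<And>z. z \<in> J \<Longrightarrow> z * (1 - z) * s' z + n / 2 * (1 - 2 * z) * slope n (\<lambda>_. 1) z = 1"
    using slope_C1[OF J n, of "\<lambda>_. 1" "\<lambda>_. 0"] by auto
  \<comment> \<open>Multiplication by (1 - x)^(n/2) turns the coefficient (n/2)(1 - 2x) into the
    constant n/2 required by \<open>singular_ode_unique\<close>.\<close>
  define p where "p s x = (1 - x) powr (n / 2) * s x" for s and x :: real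
  define p' where "p' s s' x = - (n / 2) * (1 - x) powr (n / 2 - 1) * s x + (1 - x) powr (n / 2) * s' x"
    for s s' and x :: real
  have p: "(p s has_field_derivative p' s s' x) (at x)"
    if "(s has_field_derivative s' x) (at x)" "x \<in> J" for s s' x
    unfolding p_def[abs_def] p'_def using that J(4) by (auto intro!: derivative_eq_intros simp: subset_eq)
  have ode: "x * p' s s' x + n / 2 * p s x = (1 - x) powr (n / 2 - 1)"
    if "x * (1 - x) * s' x + n / 2 * (1 - 2 * x) * s x = 1" "x \<in> J" for s s' x
  proof -
    have x1: "x < 1" using that J(4) by auto
    have D: "(1 - x) powr (n / 2) = (1 - x) powr (n / 2 - 1) * (1 - x)" using x1 by (simp add: powr_diff)
    have "x * p' s s' x + n / 2 * p s x
       = (1 - x) powr (n / 2 - 1) * (x * (1 - x) * s' x + n / 2 * (1 - 2 * x) * s x)"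
      unfolding p_def p'_def D by (simp add: algebra_simps)
    then show ?thesis using that by simp
  qed
  have "p (slope n (\<lambda>_. 1)) z = p (hyp1 n 0) z"
  proof (rule singular_ode_unique[OF J(1-3), where n = n and p = "p (slope n (\<lambda>_. 1))" and q = "p (hyp1 n 0)"])
    fix x assume x: "x \<in> J"
    then have x': "\<bar>x\<bar> < 1" by (auto simp: J_def)
    show "(p (slope n (\<lambda>_. 1)) has_field_derivative p' (slope n (\<lambda>_. 1)) s' x) (at x)"
      using p s' x by blast
    show "(p (hyp1 n 0) has_field_derivative p' (hyp1 n 0) (hyp2 n 0) x) (at x)"
      using p hyp1_deriv[of n 0 x] n x x' by auto
    show "x * p' (slope n (\<lambda>_. 1)) s' x + n / 2 * p (slope n (\<lambda>_. 1)) x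
       = x * p' (hyp1 n 0) (hyp2 n 0) x + n / 2 * p (hyp1 n 0) x"
      using ode[where s = "slope n (\<lambda>_. 1)" and s' = s', OF s'(2)[OF x] x] ode[of x "hyp2 n 0" "hyp1 n 0"] hyp_ode[of n 0 x] n x x' by simp
  qed (use n z in \<open>auto simp: J_def\<close>)
  moreover have "z \<noteq> 1" using z by auto
  ultimately show ?thesis by (simp add: p_def)
qed

lemma hyp_0: "hyp n \<mu> 0 = 0"
  by (simp add: hyp_def hyp_fps_def eval_fps_at_0)

lemma hyp_strict_mono:
  assumes n: "n \<ge> 2" and "0 \<le> x" "x < y" "y < 1"
  shows "hyp n 0 x < hyp n 0 y"
proof -
  let ?d = "\<lambda>k. hyp_coeff n 0 k * y ^ k - hyp_coeff n 0 k * x ^ k"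
  have s: "?d sums (hyp n 0 y - hyp n 0 x)"
    using assms by (intro sums_diff hyp_sums) auto
  have "0 < suminf ?d"
  proof (rule suminf_pos2[where i = 1])
    show "summable ?d" using s by (rule sums_summable)
    show "0 \<le> ?d k" for k
      using hyp_coeff_pos[OF n, of 0 "k - 1"] assms by (cases k) (auto intro!: mult_left_mono power_mono simp del: power_Suc)
    show "0 < ?d 1" using assms by (simp add: divide_strict_right_mono)
  qed
  then show ?thesis using s by (simp add: sums_iff)
qed

lemma slope_mono:
  assumes "convex J" "0 \<in> J" "J \<subseteq> {..<1}" "continuous_on J h" "continuous_on J k"
    "\<And>x. x \<in> J \<Longrightarrow> h x \<le> k x" "z \<in> J"
  shows "slope n h z \<le> slope n k z"
  unfolding slope_def using assms
  by (intro mult_left_mono avg_mono[of J] continuous_intros wt_continuous wt_nonneg) auto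

lemma slope_add_const:
  assumes "convex J" "0 \<in> J" "J \<subseteq> {..<1}" "continuous_on J h" "z \<in> J"
  shows "slope n (\<lambda>x. h x + c) z = slope n h z + c * slope n (\<lambda>_. 1) z"
proof -
  have "avg n (\<lambda>x. wt n x * h x + c * (wt n x * 1)) z = avg n (\<lambda>x. wt n x * h x) z + c * avg n (\<lambda>x. wt n x * 1) z"
    using assms by (intro avg_add_scaled[of J] continuous_intros wt_continuous) auto
  then show ?thesis by (simp add: slope_def algebra_simps)
qed

lemma slope_continuous:
  assumes "convex J" "0 \<in> J" "J \<subseteq> {..<1}" "continuous_on J h"
  shows "continuous_on J (slope n h)"
  unfolding slope_def[abs_def] using assms
  by (intro continuous_intros avg_continuous wt_continuous) auto

lemma slope_0: "slope n (\<lambda>_. 0) = (\<lambda>_. 0)"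
  by (simp add: fun_eq_iff slope_def avg_def)

text \<open>Integrates g' = - \<open>slope n h\<close> from the boundary condition g(b) = 0; the
  regularity of \<open>slope\<close> at 0 takes the place of a condition at the pole.\<close>

definition green :: "nat \<Rightarrow> real \<Rightarrow> (real \<Rightarrow> real) \<Rightarrow> real \<Rightarrow> real" where
  "green n b h z = integral {z..b} (slope n h)"

section \<open>Order, regularity and fixed points of the Green operator\<close>

context
  fixes n :: nat and a b :: real
  assumes n: "n \<ge> 2" and ab: "- 1 < a" "a < 0" "0 < b" "b < 1"
begin

lemma slope_integrable:
  assumes "continuous_on {a..b} h" "z \<in> {a..b}"
  shows "slope n h integrable_on {z..b}"
  using assms ab
  by (intro integrable_continuous_interval continuous_on_subset[OF slope_continuous[of "{a..b}"]]) auto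

lemma green_mono:
  assumes "continuous_on {a..b} h" "continuous_on {a..b} k"
    "\<And>x. x \<in> {a..b} \<Longrightarrow> h x \<le> k x" "z \<in> {a..b}"
  shows "green n b h z \<le> green n b k z"
  unfolding green_def using assms ab
  by (intro integral_le slope_integrable slope_mono[of "{a..b}"]) auto

text \<open>This is the torsion function. Its value at the pole is \<open>hyp n 0 b\<close>, because
  the series vanishes at 0.\<close>

lemma green_1:
  assumes "z \<in> {a..b}"
  shows "green n b (\<lambda>_. 1) z = hyp n 0 b - hyp n 0 z"
proof -
  have "(hyp1 n 0 has_integral (hyp n 0 b - hyp n 0 z)) {z..b}"
  proof (rule fundamental_theorem_of_calculus)
    fix x assume "x \<in> {z..b}"
    then show "(hyp n 0 has_vector_derivative hyp1 n 0 x) (at x within {z..b})"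
      using hyp_deriv[of n 0 x] n ab assms
      by (auto simp: has_real_derivative_iff_has_vector_derivative[symmetric] intro: has_field_derivative_at_within)
  qed (use assms in auto)
  moreover have "integral {z..b} (slope n (\<lambda>_. 1)) = integral {z..b} (hyp1 n 0)"
    using assms ab n by (intro integral_cong slope_1) auto
  ultimately show ?thesis by (simp add: green_def integral_unique)
qed

lemma green_add_const:
  assumes "continuous_on {a..b} h" "z \<in> {a..b}"
  shows "green n b (\<lambda>x. h x + c) z = green n b h z + c * (hyp n 0 b - hyp n 0 z)"
proof -
  have "green n b (\<lambda>x. h x + c) z = integral {z..b} (\<lambda>x. slope n h x + c * slope n (\<lambda>_. 1) x)"
    unfolding green_def using assms ab by (intro integral_cong slope_add_const[of "{a..b}"]) auto
  also have "\<dots> = green n b h z + c * green n b (\<lambda>_. 1) z"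
    unfolding green_def using assms
    by (subst integral_add) (auto intro!: slope_integrable integrable_on_mult_right)
  finally show ?thesis using green_1[OF assms(2)] by simp
qed

lemma green_const: "z \<in> {a..b} \<Longrightarrow> green n b (\<lambda>_. c) z = c * (hyp n 0 b - hyp n 0 z)"
  using green_add_const[of "\<lambda>_. 0" z c] by (simp add: green_def slope_0)

text \<open>Positive coefficients do not settle the matter at negative arguments. There the
  derivative is recognised as \<open>slope n (\<lambda>_. 1)\<close>, which is nonnegative by
  monotonicity of \<open>slope\<close>.\<close>

lemma hyp_mono:
  assumes "x \<in> {a..b}" "y \<in> {a..b}" "x \<le> y"
  shows "hyp n 0 x \<le> hyp n 0 y"
proof (rule DERIV_nonneg_imp_nondecreasing[OF assms(3)])
  fix z assume z: "x \<le> z" "z \<le> y"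
  have "slope n (\<lambda>_. 0) z \<le> slope n (\<lambda>_. 1) z"
    using z assms ab by (intro slope_mono[of "{a..b}"]) auto
  then show "\<exists>d. (hyp n 0 has_real_derivative d) (at z) \<and> 0 \<le> d"
    using z assms ab n hyp_deriv[of n 0 z] slope_1[of n z] slope_0[of n]
    by (intro exI[of _ "hyp1 n 0 z"]) auto
qed

lemma green_continuous:
  assumes "continuous_on {a..b} h"
  shows "continuous_on {a..b} (green n b h)"
  unfolding green_def[abs_def] using assms ab
  by (intro indefinite_integral_continuous_1' slope_integrable) auto

lemma green_deriv:
  assumes "continuous_on {a..b} h" "z \<in> {a<..<b}"
  shows "(green n b h has_field_derivative - slope n h z) (at z)"
proof -
  have c: "continuous_on {a..b} (slope n h)" using assms ab by (intro slope_continuous) auto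
  have "((\<lambda>x. integral {a..x} (slope n h)) has_field_derivative slope n h z) (at z within {a..b})"
    using integral_has_real_derivative[OF c, of z] assms by auto
  then have "((\<lambda>x. integral {a..x} (slope n h)) has_field_derivative slope n h z) (at z)"
    using at_within_Icc_at[of a z b] assms(2) by auto
  then have "((\<lambda>x. integral {a..b} (slope n h) - integral {a..x} (slope n h)) has_field_derivative - slope n h z) (at z)"
    by (auto intro!: derivative_eq_intros)
  then show ?thesis
  proof (rule has_field_derivative_transform_within_open[OF _ open_greaterThanLessThan assms(2)])
    fix x assume x: "x \<in> {a<..<b}"
    have "slope n h integrable_on {a..b}" using slope_integrable[OF assms(1), of a] ab by simp
    then have "integral {a..x} (slope n h) + integral {x..b} (slope n h) = integral {a..b} (slope n h)"
      using x by (intro Henstock_Kurzweil_Integration.integral_combine) auto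
    then show "integral {a..b} (slope n h) - integral {a..x} (slope n h) = green n b h x"
      by (simp add: green_def)
  qed
qed

text \<open>Contraction principle in the supremum norm: by monotonicity of the Green operator, the
  distance of two images is at most \<open>lam * L\<close> times the distance of the arguments times
  the torsion function, which is largest at \<open>a\<close>.\<close>

lemma green_fixed_point:
  assumes F: "\<And>x y. \<bar>F x - F y\<bar> \<le> L * \<bar>x - y\<bar>" and pos: "0 \<le> L" "0 \<le> lam"
    and contr: "lam * L * (hyp n 0 b - hyp n 0 a) < 1"
  obtains g where "continuous_on {a..b} g" "\<And>z. z \<in> {a..b} \<Longrightarrow> g z = lam * green n b (\<lambda>x. F (g x)) z"
proof -
  have cF: "continuous_on UNIV F"
    by (rule lipschitz_on_continuous_on[of L]) (use F pos in \<open>auto simp: lipschitz_on_def dist_real_def\<close>)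
  have cFg: "continuous_on {a..b} (\<lambda>x. F (g x))" if "continuous_on {a..b} g" for g
    using continuous_on_compose2[OF cF that] by auto
  \<comment> \<open>The contraction theorem is used on bounded continuous functions on the whole
    line, so images are extended from [a, b] by constants.\<close>
  define cl where "cl x = max a (min x b)" for x
  have cl: "cl x \<in> {a..b}" for x using ab by (auto simp: cl_def)
  have ccl: "continuous_on UNIV cl" unfolding cl_def by (intro continuous_intros)
  define T where "T g x = lam * green n b (\<lambda>x. F (apply_bcontfun g x)) (cl x)" for g x
  have T: "T g \<in> bcontfun" for g
  proof -
    have c: "continuous_on {a..b} (green n b (\<lambda>x. F (apply_bcontfun g x)))"
      by (intro green_continuous cFg) auto
    have "bounded (green n b (\<lambda>x. F (apply_bcontfun g x)) ` {a..b})"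
      by (intro compact_imp_bounded compact_continuous_image c) auto
    then obtain B where "\<forall>y \<in> green n b (\<lambda>x. F (apply_bcontfun g x)) ` {a..b}. norm y \<le> B"
      unfolding bounded_iff by blast
    then have B: "\<bar>green n b (\<lambda>x. F (apply_bcontfun g x)) x\<bar> \<le> B" if "x \<in> {a..b}" for x
      using that by auto
    show ?thesis
    proof (rule bcontfun_normI)
      show "continuous_on UNIV (T g)"
        unfolding T_def[abs_def] using cl by (intro continuous_intros continuous_on_compose2[OF c ccl]) auto
      show "norm (T g x) \<le> lam * B" for x
        using B[OF cl] pos by (auto simp: T_def abs_mult intro: mult_left_mono)
    qed
  qed
  have "dist (Bcontfun (T g)) (Bcontfun (T h)) \<le> lam * L * (hyp n 0 b - hyp n 0 a) * dist g h" for g h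
  proof (rule dist_bound)
    fix x
    let ?d = "dist g h"
    \<comment> \<open>One-sided, for a pair whose distance is \<open>?d\<close>; the absolute value
      follows by using it for both orders of the pair.\<close>
    have le: "green n b (\<lambda>x. F (apply_bcontfun g x)) (cl x)
       \<le> green n b (\<lambda>x. F (apply_bcontfun h x)) (cl x) + L * ?d * (hyp n 0 b - hyp n 0 a)" 
      if "?d = dist g h" for g h
    proof -
      have "F (apply_bcontfun g y) \<le> F (apply_bcontfun h y) + L * ?d" for y
      proof -
        have "\<bar>apply_bcontfun g y - apply_bcontfun h y\<bar> \<le> ?d"
          using dist_bounded[of g y h] that by (simp add: dist_real_def)
        then have "L * \<bar>apply_bcontfun g y - apply_bcontfun h y\<bar> \<le> L * ?d" using pos by (intro mult_left_mono)
        then show ?thesis using F[of "apply_bcontfun g y" "apply_bcontfun h y"] by linarith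
      qed
      then have "green n b (\<lambda>x. F (apply_bcontfun g x)) (cl x)
        \<le> green n b (\<lambda>x. F (apply_bcontfun h x) + L * ?d) (cl x)"
        using cl by (intro green_mono cFg continuous_intros) auto
      also have "\<dots> = green n b (\<lambda>x. F (apply_bcontfun h x)) (cl x) + L * ?d * (hyp n 0 b - hyp n 0 (cl x))"
        by (rule green_add_const[OF cFg cl]) auto
      also have "L * ?d * (hyp n 0 b - hyp n 0 (cl x)) \<le> L * ?d * (hyp n 0 b - hyp n 0 a)"
        using hyp_mono[of a "cl x"] cl[of x] ab pos by (intro mult_left_mono) auto
      finally show ?thesis by simp
    qed
    have "\<bar>green n b (\<lambda>x. F (apply_bcontfun g x)) (cl x) - green n b (\<lambda>x. F (apply_bcontfun h x)) (cl x)\<bar>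
      \<le> L * ?d * (hyp n 0 b - hyp n 0 a)"
      using le[of g h] le[of h g] by (simp add: dist_commute abs_le_iff)
    from mult_left_mono[OF this pos(2)]
    show "dist (apply_bcontfun (Bcontfun (T g)) x) (apply_bcontfun (Bcontfun (T h)) x)
       \<le> lam * L * (hyp n 0 b - hyp n 0 a) * dist g h"
      using T pos by (simp add: Bcontfun_inverse dist_real_def T_def abs_mult right_diff_distrib[symmetric] mult_ac)
  qed
  moreover have "0 \<le> lam * L * (hyp n 0 b - hyp n 0 a)"
    using pos hyp_mono[of a b] ab by auto
  ultimately obtain g where g: "Bcontfun (T g) = g"
    using banach_fix_type[of "lam * L * (hyp n 0 b - hyp n 0 a)" "\<lambda>g. Bcontfun (T g)"] contr by auto
  have "apply_bcontfun g z = lam * green n b (\<lambda>x. F (apply_bcontfun g x)) z" if "z \<in> {a..b}" for z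
  proof -
    have "apply_bcontfun g z = T g z" using T[of g] g by (metis Bcontfun_inverse)
    then show ?thesis using that by (simp add: T_def cl_def)
  qed
  then show ?thesis using that[of "apply_bcontfun g"] by auto
qed

end

text \<open>The fixed point of a truncated problem takes values in [0, s), where the truncation has
  no effect; its regularity is then bootstrapped.\<close>

lemma radial_solution_exists:
  fixes f :: "real \<Rightarrow> real"
  assumes n: "n \<ge> 2" and b: "0 < b" "b < 1"
    and f: "\<And>x. (f has_field_derivative f1 x) (at x)" "continuous_on UNIV f1"
    and mono: "mono f" and f0: "f 0 > 0"
    and s: "s > 0" "f s = L * s" and lip: "\<And>x y. x \<in> {0..s} \<Longrightarrow> y \<in> {0..s} \<Longrightarrow> \<bar>f x - f y\<bar> \<le> L * \<bar>x - y\<bar>"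
    and lam: "lam > 0" "lam * L * hyp n 0 b < 1"
  obtains a g g1 g2 where "a < 0"
    "\<And>z. a < z \<Longrightarrow> z < b \<Longrightarrow> (g has_field_derivative g1 z) (at z)"
    "\<And>z. a < z \<Longrightarrow> z < b \<Longrightarrow> (g1 has_field_derivative g2 z) (at z)"
    "continuous_on {a<..<b} g2" "continuous_on {0..b} g" "g b = 0" "\<And>z. 0 \<le> z \<Longrightarrow> z < b \<Longrightarrow> g z > 0"
    "\<And>z. a < z \<Longrightarrow> z < b \<Longrightarrow> z * (1 - z) * g2 z + n / 2 * (1 - 2 * z) * g1 z = - lam * f (g z)"
proof -
  have "f s > 0" using f0 mono s(1) by (meson less_eq_real_def less_le_trans monoD)
  then have L: "L > 0" using s by (simp add: zero_less_mult_iff)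
  \<comment> \<open>The contraction condition holds at the pole and persists slightly below 0 by
    continuity, which leaves room for two-sided derivatives at 0.\<close>
  obtain a where a: "- 1 < a" "a < 0" "lam * L * (hyp n 0 b - hyp n 0 a) < 1"
  proof -
    have "isCont (hyp n 0) 0" using hyp_deriv[of n 0 0] n by (auto intro: DERIV_isCont)
    then have "((\<lambda>x. lam * L * (hyp n 0 b - hyp n 0 x)) \<longlongrightarrow> lam * L * (hyp n 0 b - hyp n 0 0)) (at_left 0)"
      unfolding isCont_def by (intro tendsto_intros filterlim_at_split[THEN iffD1, THEN conjunct1])
    then have "eventually (\<lambda>x. lam * L * (hyp n 0 b - hyp n 0 x) < 1) (at_left 0)"
      using lam by (intro order_tendstoD(2)) (auto simp: hyp_0)
    moreover have "eventually (\<lambda>x. x \<in> {-1<..<0::real}) (at_left 0)"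
      by (rule eventually_at_leftI[of "-1"]) auto
    ultimately have "eventually (\<lambda>x. x \<in> {-1<..<0::real} \<and> lam * L * (hyp n 0 b - hyp n 0 x) < 1) (at_left 0)"
      by eventually_elim auto
    then show ?thesis using that eventually_happens'[OF trivial_limit_at_left_real] by fastforce
  qed
  note ab = n a(1,2) b
  \<comment> \<open>Clamping the argument to [0, s] makes the Lipschitz bound global and keeps the
    values between \<open>f 0\<close> and \<open>f s\<close>.\<close>
  define F where "F x = f (max 0 (min x s))" for x
  have F: "\<bar>F x - F y\<bar> \<le> L * \<bar>x - y\<bar>" for x y
  proof -
    have "\<bar>F x - F y\<bar> \<le> L * \<bar>max 0 (min x s) - max 0 (min y s)\<bar>"
      unfolding F_def using s by (intro lip) auto
    also have "\<dots> \<le> L * \<bar>x - y\<bar>" using L by (intro mult_left_mono) auto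
    finally show ?thesis .
  qed
  have Fb: "f 0 \<le> F x" "F x \<le> f s" for x
    unfolding F_def using s(1) by (intro monoD[OF mono]; simp)+
  obtain g where g: "continuous_on {a..b} g" "\<And>z. z \<in> {a..b} \<Longrightarrow> g z = lam * green n b (\<lambda>x. F (g x)) z"
    using green_fixed_point[OF ab F _ _ a(3)] L lam by auto
  define h where "h x = F (g x)" for x
  have cF: "continuous_on UNIV F"
    by (rule lipschitz_on_continuous_on[of L]) (use F L in \<open>auto simp: lipschitz_on_def dist_real_def\<close>)
  have ch: "continuous_on {a..b} h"
    unfolding h_def[abs_def] using continuous_on_compose2[OF cF g(1)] by auto
  have g': "g z = lam * green n b h z" if "z \<in> {a..b}" for z
    using g(2)[OF that] by (simp add: h_def[abs_def])
  have lower: "lam * (f 0 * (hyp n 0 b - hyp n 0 z)) \<le> g z" if z: "z \<in> {a..b}" for z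
    unfolding g'[OF z] using green_mono[OF ab continuous_on_const ch, of "f 0" z] green_const[OF ab z] Fb z lam
    by (intro mult_left_mono) (auto simp: h_def)
  \<comment> \<open>As \<open>f s = L * s\<close>, the bound obtained from
    \<open>F \<le> f s\<close> is the contraction constant times \<open>s\<close>, hence below
    \<open>s\<close>.\<close>
  have upper: "g z < s" if z: "z \<in> {a..b}" for z
  proof -
    have "g z \<le> lam * (f s * (hyp n 0 b - hyp n 0 z))"
      unfolding g'[OF z] using green_mono[OF ab ch continuous_on_const, of "f s" z] green_const[OF ab z] Fb z lam
      by (intro mult_left_mono) (auto simp: h_def)
    also have "\<dots> \<le> lam * (f s * (hyp n 0 b - hyp n 0 a))"
      using hyp_mono[OF ab, of a z] z lam \<open>f s > 0\<close> by (intro mult_left_mono) auto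
    also have "\<dots> = lam * L * (hyp n 0 b - hyp n 0 a) * s" by (simp add: s(2))
    also have "\<dots> < 1 * s" using a s by (intro mult_strict_right_mono) auto
    finally show ?thesis by simp
  qed
  have nonneg: "0 \<le> g z" if z: "z \<in> {a..b}" for z
    using order_trans[OF _ lower[OF z]] hyp_mono[OF ab, of z b] z lam f0 b by auto
  have hf: "h z = f (g z)" if z: "z \<in> {a..b}" for z
    using upper[OF z] nonneg[OF z] by (simp add: h_def F_def)
  \<comment> \<open>Bootstrap: continuity of \<open>h\<close> makes \<open>g\<close> C1, hence
    \<open>h = f \<circ> g\<close> is C1 on \<open>J\<close>, and \<open>slope_C1\<close> then makes
    \<open>g\<close> C2.\<close>
  define J where "J = {a<..<b}"
  have J: "convex J" "0 \<in> J" "open J" "J \<subseteq> {..<1}" "J \<subseteq> {a..b}" using a b by (auto simp: J_def)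
  define g1 where "g1 z = - lam * slope n h z" for z
  have dg: "(g has_field_derivative g1 z) (at z)" if z: "z \<in> J" for z
  proof (rule has_field_derivative_transform_within_open[OF _ J(3) z])
    show "((\<lambda>z. lam * green n b h z) has_field_derivative g1 z) (at z)"
      using DERIV_cmult[OF green_deriv[OF ab ch, of z], of lam] z by (simp add: g1_def J_def)
  qed (use g' J in auto)
  define h' where "h' z = f1 (g z) * g1 z" for z
  have dh: "(h has_field_derivative h' z) (at z)" if z: "z \<in> J" for z
  proof (rule has_field_derivative_transform_within_open[OF _ J(3) z])
    show "((\<lambda>z. f (g z)) has_field_derivative h' z) (at z)"
      unfolding h'_def by (rule DERIV_chain2[OF f(1) dg[OF z]])
  qed (use hf J in auto)
  have cg1: "continuous_on J g1"
    unfolding g1_def[abs_def]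
    by (intro continuous_intros slope_continuous continuous_on_subset[OF ch] J)
  have ch': "continuous_on J h'"
    unfolding h'_def[abs_def]
    by (intro continuous_intros continuous_on_compose2[OF f(2)] cg1 continuous_on_subset[OF g(1)] J) auto
  obtain s' where s': "continuous_on J s'" "\<And>z. z \<in> J \<Longrightarrow> (slope n h has_field_derivative s' z) (at z)"
      "\<And>z. z \<in> J \<Longrightarrow> z * (1 - z) * s' z + n / 2 * (1 - 2 * z) * slope n h z = h z"
    using slope_C1[OF J(1-4) n, of h h'] dh ch' by blast
  show ?thesis
  proof (rule that[of a g g1 "\<lambda>z. - lam * s' z"])
    fix z assume "a < z" "z < b"
    then have z: "z \<in> J" by (simp add: J_def)
    show "(g has_field_derivative g1 z) (at z)" by (rule dg[OF z])
    show "(g1 has_field_derivative - lam * s' z) (at z)"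
      unfolding g1_def[abs_def] by (rule DERIV_cmult[OF s'(2)[OF z]])
    have "z * (1 - z) * (- lam * s' z) + n / 2 * (1 - 2 * z) * g1 z
      = - lam * (z * (1 - z) * s' z + n / 2 * (1 - 2 * z) * slope n h z)"
      by (simp add: g1_def algebra_simps)
    then show "z * (1 - z) * (- lam * s' z) + n / 2 * (1 - 2 * z) * g1 z = - lam * f (g z)"
      using s'(3)[OF z] hf J(5) z by auto
  next
    fix z assume z: "0 \<le> z" "z < b"
    then have "lam * (f 0 * (hyp n 0 b - hyp n 0 z)) > 0"
      using hyp_strict_mono[OF n z b(2)] lam f0 by simp
    then show "g z > 0" using lower[of z] z a b by auto
  next
    show "g b = 0" using g'[of b] a b by (simp add: green_def)
    show "continuous_on {a<..<b} (\<lambda>z. - lam * s' z)" using s'(1) by (auto simp: J_def intro!: continuous_intros)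
    show "continuous_on {0..b} g" using a by (intro continuous_on_subset[OF g(1)]) auto
  qed (use a in auto)
qed

section \<open>Asymptotics of the extremal parameter\<close>

lemma cap_level_bounds:
  assumes "0 < \<epsilon>" "\<epsilon> < 1"
  shows "0 < cap_level \<epsilon>" "cap_level \<epsilon> < 1"
proof -
  have "cos pi < cos ((1 - \<epsilon>) * pi)" "cos ((1 - \<epsilon>) * pi) < cos 0"
    using assms by (intro cos_monotone_0_pi; simp add: mult_le_cancel_right1)+
  then show "0 < cap_level \<epsilon>" "cap_level \<epsilon> < 1" by (auto simp: cap_level_def)
qed

text \<open>The distance of \<open>cap_level \<epsilon>\<close> to 1 is (1 - cos(\<epsilon> pi))/2,
  which tends to 0, so the logarithmic lower bound diverges.\<close>

lemma hyp_cap_level_at_top: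
  assumes n: "n \<ge> 2"
  shows "filterlim (\<lambda>\<epsilon>. hyp n 0 (cap_level \<epsilon>)) at_top (at_right 0)"
proof (rule filterlim_at_top_mono)
  have "real n > 0" using n by simp
  then show "filterlim (\<lambda>\<epsilon>. - 2 / n * ln ((1 - cos (\<epsilon> * pi)) / 2)) at_top (at_right 0)"
    by real_asymp
  have "eventually (\<lambda>\<epsilon>. \<epsilon> \<in> {0<..<1::real}) (at_right 0)" by (rule eventually_at_rightI[of _ 1]) auto
  then show "eventually (\<lambda>\<epsilon>. - 2 / n * ln ((1 - cos (\<epsilon> * pi)) / 2) \<le> hyp n 0 (cap_level \<epsilon>)) (at_right 0)"
  proof eventually_elim
    case (elim \<epsilon>)
    have "cos ((1 - \<epsilon>) * pi) = - cos (\<epsilon> * pi)"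
      by (simp add: left_diff_distrib cos_diff)
    then have eq: "(1 - cos (\<epsilon> * pi)) / 2 = 1 - cap_level \<epsilon>" by (simp add: cap_level_def field_simps)
    show ?case unfolding eq using hyp_ge_ln[OF n, of "cap_level \<epsilon>"] cap_level_bounds[of \<epsilon>] elim by auto
  qed
qed

lemma sphere_domain_cap: "sphere_domain (cap \<epsilon> :: ((real^'n) \<times> real) set)"
  by unfold_locales (auto simp: mem_cap_iff open_cone_over_cap)

text \<open>The eigenfunction has profile \<open>1 - \<mu> * hyp n \<mu>\<close>, with n the
  dimension of the sphere. It equals 1 at the pole, and the choice of \<open>\<mu>\<close> makes it
  vanish on the boundary.\<close>

lemma cap_eigenvalue_exists:
  fixes S :: real
  assumes n: "CARD('n::finite) \<ge> 2" and \<epsilon>: "0 < \<epsilon>" "\<epsilon> < 1"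
  defines "S \<equiv> hyp CARD('n) 0 (cap_level \<epsilon>)"
  assumes S: "S \<ge> 5"
  obtains \<mu> u where "\<mu> \<le> (1 + 2 / S) / S" "classical_on (cap \<epsilon> :: ((real^'n) \<times> real) set) u"
    "\<exists>x\<in>cap \<epsilon>. u x \<noteq> 0" "\<forall>x\<in>sphere_bdry (cap \<epsilon>). u x = 0" "\<forall>x\<in>cap \<epsilon>. - sphere_laplacian u x = \<mu> * u x"
proof -
  let ?n = "CARD('n)"
  note b = cap_level_bounds[OF \<epsilon>]
  obtain \<mu> where \<mu>: "0 < \<mu>" "\<mu> \<le> 1" "\<mu> \<le> (1 + 2 / S) / S" "\<mu> * hyp ?n \<mu> (cap_level \<epsilon>) = 1"
    using hyp_eigenvalue_exists[OF n b S[unfolded S_def]] unfolding S_def by blast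
  define g where "g z = 1 - \<mu> * hyp ?n \<mu> z" for z
  define g1 where "g1 z = - \<mu> * hyp1 ?n \<mu> z" for z
  define g2 where "g2 z = - \<mu> * hyp2 ?n \<mu> z" for z
  have g: "(g has_field_derivative g1 z) (at z)" "(g1 has_field_derivative g2 z) (at z)"
    if "-1 < z" "z < 1" for z
    unfolding g_def[abs_def] g1_def[abs_def] g2_def using that n \<mu>
    by (auto intro!: derivative_eq_intros hyp_deriv hyp1_deriv)
  have g2: "continuous_on {-1<..<cap_level \<epsilon>} g2"
    unfolding g2_def[abs_def] using n \<mu> b
    by (intro continuous_intros continuous_at_imp_continuous_on ballI hyp2_cont) auto
  have cg: "continuous_on {0..cap_level \<epsilon>} g"
    using b by (intro continuous_at_imp_continuous_on ballI DERIV_isCont[OF g(1)]) auto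
  show ?thesis
  proof (rule that[OF \<mu>(3), of "zonal g"])
    show "classical_on (cap \<epsilon> :: ((real^'n) \<times> real) set) (zonal g)"
      by (rule zonal_classical[OF _ g(1) g(2) g2 cg]) (use b in auto)
    have "(0, 1) \<in> (cap \<epsilon> :: ((real^'n) \<times> real) set)" "zonal g (0 :: real^'n, 1) = 1"
      using b by (auto simp: mem_cap_iff norm_Pair zonal_def g_def hyp_0)
    then show "\<exists>x\<in>(cap \<epsilon> :: ((real^'n) \<times> real) set). zonal g x \<noteq> 0" by (metis zero_neq_one)
    show "\<forall>x\<in>sphere_bdry (cap \<epsilon> :: ((real^'n) \<times> real) set). zonal g x = 0"
      using zonal_sphere_bdry[of g \<epsilon>] \<mu> by (auto simp: g_def)
    show "\<forall>x\<in>(cap \<epsilon> :: ((real^'n) \<times> real) set). - sphere_laplacian (zonal g) x = \<mu> * zonal g x"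
    proof
      fix x :: "(real^'n) \<times> real" assume x: "x \<in> cap \<epsilon>"
      define z where "z = (1 - snd x) / 2"
      have z: "\<bar>z\<bar> < 1" using closure_cap(2)[OF subsetD[OF closure_subset x]] x b by (auto simp: mem_cap_iff z_def)
      have "sphere_laplacian (zonal g) x = z * (1 - z) * g2 z + ?n / 2 * (1 - 2 * z) * g1 z"
        unfolding z_def by (rule zonal_sphere_laplacian[OF _ g(1) g(2) g2 x]) (use b in auto)
      also have "\<dots> = - \<mu> * (z * (1 - z) * hyp2 ?n \<mu> z + ?n / 2 * (1 - 2 * z) * hyp1 ?n \<mu> z + \<mu> * hyp ?n \<mu> z)
          + \<mu> * (\<mu> * hyp ?n \<mu> z)"
        by (simp add: g1_def g2_def algebra_simps)
      also have "\<dots> = - (\<mu> * zonal g x)"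
        unfolding hyp_ode[OF n \<mu>(2) z] by (simp add: zonal_def g_def z_def algebra_simps)
      finally show "- sphere_laplacian (zonal g) x = \<mu> * zonal g x" by simp
    qed
  qed
qed

lemma cap_solution_exists:
  fixes f :: "real \<Rightarrow> real"
  assumes n: "CARD('n::finite) \<ge> 2" and \<epsilon>: "0 < \<epsilon>" "\<epsilon> < 1"
    and f: "\<And>x. (f has_field_derivative f1 x) (at x)" "continuous_on UNIV f1"
    and mono: "mono f" and f0: "f 0 > 0"
    and s: "s > 0" "f s = L * s" and lip: "\<And>x y. x \<in> {0..s} \<Longrightarrow> y \<in> {0..s} \<Longrightarrow> \<bar>f x - f y\<bar> \<le> L * \<bar>x - y\<bar>"
    and lam: "lam > 0" "lam * L * hyp CARD('n) 0 (cap_level \<epsilon>) < 1"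
  obtains u where "classical_on (cap \<epsilon> :: ((real^'n) \<times> real) set) u"
    "\<forall>x\<in>cap \<epsilon>. u x > 0" "\<forall>x\<in>sphere_bdry (cap \<epsilon>). u x = 0" "\<forall>x\<in>cap \<epsilon>. - sphere_laplacian u x = lam * f (u x)"
proof -
  let ?n = "CARD('n)"
  note b = cap_level_bounds[OF \<epsilon>]
  obtain a g g1 g2 where a: "a < 0"
    and g: "\<And>z. a < z \<Longrightarrow> z < cap_level \<epsilon> \<Longrightarrow> (g has_field_derivative g1 z) (at z)"
    "\<And>z. a < z \<Longrightarrow> z < cap_level \<epsilon> \<Longrightarrow> (g1 has_field_derivative g2 z) (at z)"
    "continuous_on {a<..<cap_level \<epsilon>} g2"
    and cg: "continuous_on {0..cap_level \<epsilon>} g" and g0: "g (cap_level \<epsilon>) = 0"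
    and gpos: "\<And>z. 0 \<le> z \<Longrightarrow> z < cap_level \<epsilon> \<Longrightarrow> g z > 0"
    and ode: "\<And>z. a < z \<Longrightarrow> z < cap_level \<epsilon> \<Longrightarrow> z * (1 - z) * g2 z + ?n / 2 * (1 - 2 * z) * g1 z = - lam * f (g z)"
    using radial_solution_exists[OF n b f mono f0 s lip lam] by blast
  have z: "0 \<le> (1 - snd x) / 2" "(1 - snd x) / 2 < cap_level \<epsilon>" if "x \<in> cap \<epsilon>" for x :: "(real^'n) \<times> real"
    using closure_cap(2)[OF subsetD[OF closure_subset that]] that by (auto simp: mem_cap_iff)
  show ?thesis
  proof (rule that[of "zonal g"])
    show "classical_on (cap \<epsilon> :: ((real^'n) \<times> real) set) (zonal g)"
      by (rule zonal_classical[OF a g cg])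
    show "\<forall>x\<in>(cap \<epsilon> :: ((real^'n) \<times> real) set). zonal g x > 0"
      unfolding zonal_def using z gpos by blast
    show "\<forall>x\<in>sphere_bdry (cap \<epsilon> :: ((real^'n) \<times> real) set). zonal g x = 0"
      using zonal_sphere_bdry[of g \<epsilon>] g0 by auto
    show "\<forall>x\<in>(cap \<epsilon> :: ((real^'n) \<times> real) set). - sphere_laplacian (zonal g) x = lam * f (zonal g x)"
    proof
      fix x :: "(real^'n) \<times> real" assume x: "x \<in> cap \<epsilon>"
      then have "a < (1 - snd x) / 2" using z(1)[OF x] a by linarith
      then show "- sphere_laplacian (zonal g) x = lam * f (zonal g x)"
        using zonal_sphere_laplacian[OF a g x] ode[of "(1 - snd x) / 2"] z(2)[OF x] by (simp add: zonal_def)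
    qed
  qed
qed

section \<open>Properties of the nonlinearity\<close>

lemma C2_on_UNIV_real_derivative:
  fixes f :: "real \<Rightarrow> real"
  assumes "C2_on UNIV f"
  obtains f1 where "\<And>x. (f has_field_derivative f1 x) (at x)" "continuous_on UNIV f1"
proof (rule that[of "\<lambda>x. frechet_derivative f (at x) 1"])
  show "(f has_field_derivative frechet_derivative f (at x) 1) (at x)" for x
  proof -
    have "f differentiable at x" using assms by (simp add: C2_on_def)
    then obtain D where D: "(f has_field_derivative D) (at x)"
      by (metis real_differentiableE)
    then have "frechet_derivative f (at x) = (\<lambda>h. D * h)"
      unfolding has_field_derivative_def by (rule frechet_derivative_at[symmetric])
    then show ?thesis using D by simp
  qed
  show "continuous_on UNIV (\<lambda>x. frechet_derivative f (at x) 1)"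
    using assms unfolding C2_on_def by (intro continuous_at_imp_continuous_on ballI differentiable_imp_continuous_within) auto
qed

text \<open>The ratio is at least its value \<open>f 1\<close> at 1 both near 0 and far out, so a
  minimum over a compact interval containing 1 is global.\<close>

lemma superlinear_ratio_attains_min:
  fixes f :: "real \<Rightarrow> real"
  assumes cont: "continuous_on UNIV f" and mono: "mono f" and f0: "f 0 > 0"
    and superlin: "filterlim (\<lambda>s. f s / s) at_top at_top"
  obtains s where "s > 0" "\<And>x. x > 0 \<Longrightarrow> f s / s \<le> f x / x"
proof -
  obtain B where B: "\<And>x. x \<ge> B \<Longrightarrow> f 1 \<le> f x / x"
    using superlin unfolding filterlim_at_top eventually_at_top_linorder by meson
  have f1: "f 1 \<ge> f 0" using monoD[OF mono, of 0 1] by simp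
  \<comment> \<open>For 0 < x < \<delta>, monotonicity gives f(x)/x >= f(0)/x > f(1).\<close>
  define \<delta> where "\<delta> = f 0 / f 1"
  have \<delta>: "0 < \<delta>" "\<delta> \<le> 1" using f0 f1 by (auto simp: \<delta>_def)
  have "continuous_on {\<delta>..max 1 B} (\<lambda>x. f x / x)"
    using \<delta> by (intro continuous_intros continuous_on_subset[OF cont]) auto
  moreover have "{\<delta>..max 1 B} \<noteq> {}" using \<delta> by simp
  ultimately obtain s where s: "s \<in> {\<delta>..max 1 B}" "\<And>x. x \<in> {\<delta>..max 1 B} \<Longrightarrow> f s / s \<le> f x / x"
    using continuous_attains_inf[of "{\<delta>..max 1 B}" "\<lambda>x. f x / x", OF compact_Icc] by blast
  have s1: "f s / s \<le> f 1" using s(2)[of 1] \<delta> by simp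
  show ?thesis
  proof (rule that[of s])
    show "s > 0" using s \<delta> by auto
    fix x :: real assume x: "x > 0"
    consider "x < \<delta>" | "x \<in> {\<delta>..max 1 B}" | "x > max 1 B" by fastforce
    then show "f s / s \<le> f x / x"
    proof cases
      case 1
      have "f 1 * x \<le> f 0" using 1 f0 f1 by (simp add: \<delta>_def field_simps)
      also have "f 0 \<le> f x" using x by (intro monoD[OF mono]) simp
      finally have "f 1 \<le> f x / x" using x by (simp add: field_simps)
      then show ?thesis using s1 by linarith
    next
      case 3
      then show ?thesis using B[of x] s1 by linarith
    qed (rule s(2))
  qed
qed

text \<open>The difference f(x) - L x is minimal among positive x at \<open>s\<close>, so the
  derivative of \<open>f\<close> at \<open>s\<close> is \<open>L\<close>. Convexity keeps the
  derivative at most \<open>L\<close> to the left of \<open>s\<close>, and monotonicity controls the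
  other sign.\<close>

lemma convex_lipschitz_below_ratio_minimum:
  fixes f :: "real \<Rightarrow> real"
  assumes f: "\<And>x. (f has_field_derivative f1 x) (at x)" and convex: "convex_on UNIV f" and mono: "mono f"
    and s: "s > 0" "f s = L * s" "\<And>x. x > 0 \<Longrightarrow> L * x \<le> f x"
    and x: "x \<le> s" "y \<le> s"
  shows "\<bar>f x - f y\<bar> \<le> L * \<bar>x - y\<bar>"
proof -
  have tangent: "f1 c * (x - c) \<le> f x - f c" for x c
    by (rule convex_on_imp_above_tangent[OF convex]) (use f in auto)
  have "((\<lambda>x. f x - L * x) has_field_derivative f1 s - L) (at s)"
    by (auto intro!: derivative_eq_intros f)
  then have "f1 s - L = 0"
    by (rule DERIV_local_min[of _ _ _ s]) (use s in auto)
  then have le: "f y - f x \<le> L * (y - x)" if "x \<le> y" "y \<le> s" for x y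
  proof -
    have "f1 y \<le> L"
    proof (cases "y = s")
      case False
      \<comment> \<open>Sum of the tangent inequalities at \<open>s\<close> and at \<open>y\<close>:
        monotonicity of the derivative.\<close>
      have "(f1 y - L) * (s - y) \<le> 0"
        using tangent[of y s] tangent[of s y] \<open>f1 s - L = 0\<close> by (simp add: algebra_simps)
      then show ?thesis using False that by (simp add: mult_le_0_iff)
    qed (use \<open>f1 s - L = 0\<close> in simp)
    then have "f1 y * (y - x) \<le> L * (y - x)" using that by (intro mult_right_mono) auto
    then show ?thesis using tangent[of y x] by (simp add: algebra_simps)
  qed
  show ?thesis
    using le[of x y] le[of y x] x monoD[OF mono, of x y] monoD[OF mono, of y x] by (cases "x \<le> y") auto
qed

theorem theorem1p3:
  fixes f :: "real \<Rightarrow> real"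
  assumes N: "CARD('n::finite) \<ge> 2"
    and f_C2: "C2_on UNIV f"
    and f_convex: "convex_on UNIV f"
    and f_mono: "mono f"
    and f0: "f 0 > 0"
    and f_superlin: "filterlim (\<lambda>s. f s / s) at_top at_top"
  defines "a_star \<equiv> Inf ((\<lambda>s. f s / s) ` {0<..})"
  shows "((\<lambda>\<epsilon>. extremal_parameter f (cap \<epsilon> :: ((real^'n) \<times> real) set)
              / (principal_eigenvalue (cap \<epsilon> :: ((real^'n) \<times> real) set) / a_star))
           \<longlongrightarrow> 1) (at_right 0)"
proof -
  obtain f1 where f1: "\<And>x. (f has_field_derivative f1 x) (at x)" "continuous_on UNIV f1"
    using C2_on_UNIV_real_derivative[OF f_C2] by blast
  have "continuous_on UNIV f"
    using f1(1) by (intro continuous_at_imp_continuous_on ballI DERIV_isCont)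
  then obtain s where s: "s > 0" "\<And>x. x > 0 \<Longrightarrow> f s / s \<le> f x / x"
    using superlinear_ratio_attains_min f_mono f0 f_superlin by blast
  have a_star: "a_star = f s / s"
    unfolding a_star_def by (rule cInf_eq_minimum) (use s in auto)
  then have fs: "f s = a_star * s" using s(1) by simp
  have fle: "a_star * x \<le> f x" if "x > 0" for x
    using s(1) s(2)[OF that] that by (simp add: a_star field_simps)
  have "f s > 0" using f0 monoD[OF f_mono, of 0 s] s(1) by linarith
  then have a: "a_star > 0" using s(1) fs by (simp add: zero_less_mult_iff)
  have lip: "\<bar>f x - f y\<bar> \<le> a_star * \<bar>x - y\<bar>" if "x \<in> {0..s}" "y \<in> {0..s}" for x y
    using that by (intro convex_lipschitz_below_ratio_minimum[OF f1(1) f_convex f_mono s(1) fs fle]) auto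
  let ?cap = "\<lambda>\<epsilon>. cap \<epsilon> :: ((real^'n) \<times> real) set"
  define S where "S \<epsilon> = hyp CARD('n) 0 (cap_level \<epsilon>)" for \<epsilon>
  define r where "r \<epsilon> = extremal_parameter f (?cap \<epsilon>) / (principal_eigenvalue (?cap \<epsilon>) / a_star)" for \<epsilon>
  have bounds: "1 / (1 + 2 / S \<epsilon>) \<le> r \<epsilon> \<and> r \<epsilon> \<le> 1" if \<epsilon>: "0 < \<epsilon>" "\<epsilon> < 1" and S: "S \<epsilon> \<ge> 5" for \<epsilon>
  proof -
    define E where "E = {lam. \<exists>u. classical_on (?cap \<epsilon>) u \<and> (\<exists>x\<in>?cap \<epsilon>. u x \<noteq> 0) \<and>
       (\<forall>x\<in>sphere_bdry (?cap \<epsilon>). u x = 0) \<and> (\<forall>x\<in>?cap \<epsilon>. - sphere_laplacian u x = lam * u x)}"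
    define X where "X = {lam. lam > 0 \<and> (\<exists>u. classical_on (?cap \<epsilon>) u \<and> (\<forall>x\<in>?cap \<epsilon>. u x > 0) \<and>
       (\<forall>x\<in>sphere_bdry (?cap \<epsilon>). u x = 0) \<and> (\<forall>x\<in>?cap \<epsilon>. - sphere_laplacian u x = lam * f (u x)))}"
    interpret sphere_domain "?cap \<epsilon>" by (rule sphere_domain_cap)
    obtain \<mu> u where \<mu>: "\<mu> \<le> (1 + 2 / S \<epsilon>) / S \<epsilon>" and
      u: "classical_on (?cap \<epsilon>) u" "\<exists>x\<in>?cap \<epsilon>. u x \<noteq> 0" "\<forall>x\<in>sphere_bdry (?cap \<epsilon>). u x = 0"
        "\<forall>x\<in>?cap \<epsilon>. - sphere_laplacian u x = \<mu> * u x"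
      by (rule cap_eigenvalue_exists[OF N \<epsilon> S[unfolded S_def], folded S_def])
    have \<mu>E: "\<mu> \<in> E" unfolding E_def by (intro CollectI exI[of _ u] conjI u)
    \<comment> \<open>Below this threshold the contraction constant
      \<open>lam * a_star * S \<epsilon>\<close> is less than 1.\<close>
    have X: "lam \<in> X" if lam: "0 < lam" "lam < 1 / (a_star * S \<epsilon>)" for lam
    proof -
      have c: "lam * a_star * hyp CARD('n) 0 (cap_level \<epsilon>) < 1"
        using lam a S by (simp add: S_def field_simps)
      obtain u where "classical_on (?cap \<epsilon>) u" "\<forall>x\<in>?cap \<epsilon>. u x > 0"
          "\<forall>x\<in>sphere_bdry (?cap \<epsilon>). u x = 0" "\<forall>x\<in>?cap \<epsilon>. - sphere_laplacian u x = lam * f (u x)"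
        by (rule cap_solution_exists[OF N \<epsilon> f1 f_mono f0 s(1) fs _ lam(1) c], erule (1) lip) (rule that)
      then show ?thesis unfolding X_def using lam(1) by (intro CollectI conjI exI[of _ u])
    qed
    \<comment> \<open>Comparison of a solution with an arbitrary eigenfunction, with rate
      \<open>lam * a_star\<close> from the minimal ratio and uniform lower bound
      \<open>lam * f 0\<close>.\<close>
    have XE: "0 \<le> \<nu> \<and> lam * a_star \<le> \<nu>" if "lam \<in> X" "\<nu> \<in> E" for lam \<nu>
    proof -
      from that(2) obtain \<phi> where \<phi>: "classical_on (?cap \<epsilon>) \<phi>" "\<exists>x\<in>?cap \<epsilon>. \<phi> x \<noteq> 0"
        "\<forall>x\<in>sphere_bdry (?cap \<epsilon>). \<phi> x = 0" "\<forall>x\<in>?cap \<epsilon>. - sphere_laplacian \<phi> x = \<nu> * \<phi> x"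
        unfolding E_def mem_Collect_eq by (elim exE conjE)
      from that(1) obtain u where u: "lam > 0" "classical_on (?cap \<epsilon>) u" "\<forall>x\<in>?cap \<epsilon>. u x > 0"
        "\<forall>x\<in>sphere_bdry (?cap \<epsilon>). u x = 0" "\<forall>x\<in>?cap \<epsilon>. - sphere_laplacian u x = lam * f (u x)"
        unfolding X_def mem_Collect_eq by (elim exE conjE)
      have "- sphere_laplacian u x \<ge> lam * f 0" "- sphere_laplacian u x \<ge> lam * a_star * u x"
        if "x \<in> ?cap \<epsilon>" for x
        using u(1) bspec[OF u(3) that] bspec[OF u(5) that] fle[of "u x"] monoD[OF f_mono, of 0 "u x"]
        by (auto simp: mult.assoc intro!: mult_left_mono)
      from eigenvalue_ge_supersolution_rate[OF \<phi>(1,2) bspec[OF \<phi>(3)] bspec[OF \<phi>(4)]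
          u(2) bspec[OF u(3)] bspec[OF u(4)] this] u(1) f0
      show ?thesis by simp
    qed
    \<comment> \<open>Half the existence threshold: a concrete element of \<open>X\<close>, used to
      bound \<open>E\<close> from below and to see that its infimum is positive.\<close>
    define lam0 where "lam0 = 1 / (2 * a_star * S \<epsilon>)"
    have lam0: "lam0 \<in> X" "lam0 > 0" using X[of lam0] a S by (auto simp: lam0_def field_simps)
    have bE: "bdd_below E" using XE[OF lam0(1)] by (auto intro!: bdd_belowI[of _ 0])
    define l where "l = Inf E"
    have l_le: "l \<le> (1 + 2 / S \<epsilon>) / S \<epsilon>" using cInf_lower[OF \<mu>E bE] \<mu> by (simp add: l_def)
    have l_ge: "lam * a_star \<le> l" if "lam \<in> X" for lam
      unfolding l_def using \<mu>E XE[OF that] by (intro cInf_greatest) auto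
    have l: "l > 0" using l_ge[OF lam0(1)] lam0(2) a by (smt (verit) mult_pos_pos)
    have le: "lam \<le> l / a_star" if "lam \<in> X" for lam using l_ge[OF that] a by (simp add: field_simps)
    define x where "x = Sup X"
    have x_le: "x \<le> l / a_star" unfolding x_def by (rule cSup_least) (use lam0 le in auto)
    have "bdd_above X" using le by (auto intro!: bdd_aboveI)
    then have x_ge: "lam \<le> x" if "0 < lam" "lam < 1 / (a_star * S \<epsilon>)" for lam
      unfolding x_def using X[OF that] by (intro cSup_upper) auto
    \<comment> \<open>The threshold itself need not belong to \<open>X\<close>; every smaller
      positive number does, and density gives the bound.\<close>
    have x: "1 / (a_star * S \<epsilon>) \<le> x"
    proof (rule dense_le_bounded)
      show "0 < 1 / (a_star * S \<epsilon>)" using a S by simp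
    qed (rule x_ge)
    have r: "r \<epsilon> = x / (l / a_star)"
      by (simp add: r_def x_def l_def X_def E_def extremal_parameter_def principal_eigenvalue_def)
    have "r \<epsilon> \<le> 1" unfolding r using x_le l a by (simp add: field_simps)
    moreover have "1 / (1 + 2 / S \<epsilon>) \<le> r \<epsilon>"
    proof -
      \<comment> \<open>The lower bound on \<open>x\<close> is divided by the upper bound on
        \<open>l / a_star\<close>; the factors \<open>S \<epsilon>\<close> and \<open>a_star\<close>
        cancel.\<close>
      have "1 / (1 + 2 / S \<epsilon>) = (1 / (a_star * S \<epsilon>)) / ((1 + 2 / S \<epsilon>) / S \<epsilon> / a_star)"
        using a S by (simp add: field_simps)
      also have "\<dots> \<le> x / (l / a_star)"
        using x l_le l a S by (intro frac_le divide_right_mono) (auto intro: order_trans[rotated])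
      finally show ?thesis unfolding r .
    qed
    ultimately show ?thesis by simp
  qed
  have Slim: "filterlim S at_top (at_right 0)"
    unfolding S_def[abs_def] by (rule hyp_cap_level_at_top[OF N])
  have "eventually (\<lambda>\<epsilon>. \<epsilon> \<in> {0<..<1::real}) (at_right 0)" by (rule eventually_at_rightI[of _ 1]) auto
  moreover have "eventually (\<lambda>\<epsilon>. S \<epsilon> \<ge> 5) (at_right 0)"
    using Slim by (simp add: filterlim_at_top)
  ultimately have ev: "eventually (\<lambda>\<epsilon>. 1 / (1 + 2 / S \<epsilon>) \<le> r \<epsilon> \<and> r \<epsilon> \<le> 1) (at_right 0)"
    by eventually_elim (use bounds in auto)
  have "((\<lambda>\<epsilon>. 2 / S \<epsilon>) \<longlongrightarrow> 0) (at_right 0)"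
    by (rule real_tendsto_divide_at_top[OF tendsto_const Slim])
  from tendsto_divide[OF tendsto_const tendsto_add[OF tendsto_const this], of 1 1]
  have "((\<lambda>\<epsilon>. 1 / (1 + 2 / S \<epsilon>)) \<longlongrightarrow> 1) (at_right 0)" by simp
  then have "(r \<longlongrightarrow> 1) (at_right 0)"
    by (rule tendsto_sandwich[rotated 2, OF _ tendsto_const]) (use ev in \<open>auto elim: eventually_mono\<close>)
  then show ?thesis by (simp add: r_def[abs_def])
qed

end
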